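(* Let $(\mathfrak g,\alpha_{\mathfrak g})$ be a finite dimensional capable regular Hom-Leibniz algebra over a field $\mathbb K$ such that $(\mathfrak g,\alpha_{\mathfrak g})=(\mathfrak g_1\oplus\mathfrak g_2,\alpha_{\mathfrak g_1\oplus\mathfrak g_2})$ is a direct sum of Hom-Leibniz algebras $(\mathfrak g_1,\alpha_{\mathfrak g_1})$ and $(\mathfrak g_2,\alpha_{\mathfrak g_2})$. Then $(\mathfrak g_1,\alpha_{\mathfrak g_1})$ and $(\mathfrak g_2,\alpha_{\mathfrak g_2})$ are capable.
   Context: All vector spaces and linear maps are over a fixed field $\mathbb K$. A (multiplicative) Hom-Leibniz algebra $(\mathfrak g,\alpha_{\mathfrak g})$ is a vector space $\mathfrak g$ with a bilinear product $[\,,]$ and a linear map $\alpha_{\mathfrak g}$ such that $[\alpha_{\mathfrak g}(x),[y,z]]=[[x,y],\alpha_{\mathfrak g}(z)]-[[x,z],\alpha_{\mathfrak g}(y)]$ and $\alpha_{\mathfrak g}([x,y])=[\alpha_{\mathfrak g}(x),\alpha_{\mathfrak g}(y)]$. It is regular if $\alpha_{\mathfrak g}$ is bijective. Isomorphisms are bijective linear maps preserving products and commuting with the self-maps. The direct sum has componentwise product and self-map $\alpha_{\mathfrak g_1}\oplus\alpha_{\mathfrak g_2}$. The $\alpha$-center is $Z_\alpha(\mathfrak g)=\{x\in\mathfrak g\mid[\alpha_{\mathfrak g}^n(x),y]=[y,\alpha_{\mathfrak g}^n(x)]=0\text{ for all }y\in\mathfrak g,\ n\ge0\}$ (an ideal).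 $(\mathfrak g,\alpha_{\mathfrak g})$ is capable if there is a Hom-Leibniz algebra $(\mathfrak k,\alpha_{\mathfrak k})$ with $(\mathfrak g,\alpha_{\mathfrak g})\cong(\mathfrak k/Z_\alpha(\mathfrak k),\bar\alpha_{\mathfrak k})$, $\bar\alpha_{\mathfrak k}$ being the induced map. *)

theory Defs
  imports "HOL-Algebra.Module" "HOL-Algebra.QuotRing"
begin

text \<open>
  An algebra with a self-map is a \<^type>\<open>module\<close> record whose ring multiplication
  \<^const>\<open>mult\<close> plays the role of the (nonassociative) product \<open>[x,y]\<close>, extended by the
  self-map \<open>twist\<close>.  The component \<^const>\<open>one\<close> of the record is never constrained.
\<close>

record ('k, 'v) hom_algebra = "('k, 'v) module" +
  twist :: "'v \<Rightarrow> 'v"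

locale hom_leibniz_algebra = K?: field K + module K L
  for K :: "('k, 'm) ring_scheme" (structure) and L :: "('k, 'v) hom_algebra" (structure) +
  assumes bracket_closed:
      "\<And>x y. x \<in> carrier L \<Longrightarrow> y \<in> carrier L \<Longrightarrow> x \<otimes>\<^bsub>L\<^esub> y \<in> carrier L"
    and bracket_add_left:
      "\<And>x y z. x \<in> carrier L \<Longrightarrow> y \<in> carrier L \<Longrightarrow> z \<in> carrier L \<Longrightarrow>
        (x \<oplus>\<^bsub>L\<^esub> y) \<otimes>\<^bsub>L\<^esub> z = x \<otimes>\<^bsub>L\<^esub> z \<oplus>\<^bsub>L\<^esub> y \<otimes>\<^bsub>L\<^esub> z"
    and bracket_add_right:
      "\<And>x y z. x \<in> carrier L \<Longrightarrow> y \<in> carrier L \<Longrightarrow> z \<in> carrier L \<Longrightarrow>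
        x \<otimes>\<^bsub>L\<^esub> (y \<oplus>\<^bsub>L\<^esub> z) = x \<otimes>\<^bsub>L\<^esub> y \<oplus>\<^bsub>L\<^esub> x \<otimes>\<^bsub>L\<^esub> z"
    and bracket_smult_left:
      "\<And>c x y. c \<in> carrier K \<Longrightarrow> x \<in> carrier L \<Longrightarrow> y \<in> carrier L \<Longrightarrow>
        (c \<odot>\<^bsub>L\<^esub> x) \<otimes>\<^bsub>L\<^esub> y = c \<odot>\<^bsub>L\<^esub> (x \<otimes>\<^bsub>L\<^esub> y)"
    and bracket_smult_right:
      "\<And>c x y. c \<in> carrier K \<Longrightarrow> x \<in> carrier L \<Longrightarrow> y \<in> carrier L \<Longrightarrow>
        x \<otimes>\<^bsub>L\<^esub> (c \<odot>\<^bsub>L\<^esub> y) = c \<odot>\<^bsub>L\<^esub> (x \<otimes>\<^bsub>L\<^esub> y)"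
    and twist_closed:
      "\<And>x. x \<in> carrier L \<Longrightarrow> twist L x \<in> carrier L"
    and twist_add:
      "\<And>x y. x \<in> carrier L \<Longrightarrow> y \<in> carrier L \<Longrightarrow>
        twist L (x \<oplus>\<^bsub>L\<^esub> y) = twist L x \<oplus>\<^bsub>L\<^esub> twist L y"
    and twist_smult:
      "\<And>c x. c \<in> carrier K \<Longrightarrow> x \<in> carrier L \<Longrightarrow>
        twist L (c \<odot>\<^bsub>L\<^esub> x) = c \<odot>\<^bsub>L\<^esub> twist L x"
    and hom_leibniz_identity:
      "\<And>x y z. x \<in> carrier L \<Longrightarrow> y \<in> carrier L \<Longrightarrow> z \<in> carrier L \<Longrightarrow>
        twist L x \<otimes>\<^bsub>L\<^esub> (y \<otimes>\<^bsub>L\<^esub> z) =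
        ((x \<otimes>\<^bsub>L\<^esub> y) \<otimes>\<^bsub>L\<^esub> twist L z) \<ominus>\<^bsub>L\<^esub> ((x \<otimes>\<^bsub>L\<^esub> z) \<otimes>\<^bsub>L\<^esub> twist L y)"
    and twist_bracket:
      "\<And>x y. x \<in> carrier L \<Longrightarrow> y \<in> carrier L \<Longrightarrow>
        twist L (x \<otimes>\<^bsub>L\<^esub> y) = twist L x \<otimes>\<^bsub>L\<^esub> twist L y"

definition regular :: "('k, 'v) hom_algebra \<Rightarrow> bool"
  where "regular L \<longleftrightarrow> bij_betw (twist L) (carrier L) (carrier L)"

definition finite_dimensional :: "('k, 'm) ring_scheme \<Rightarrow> ('k, 'v) hom_algebra \<Rightarrow> bool"
  where "finite_dimensional K L \<longleftrightarrow>
    (\<exists>S. finite S \<and> S \<subseteq> carrier L \<and>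
      (\<forall>v\<in>carrier L. \<exists>c\<in>S \<rightarrow> carrier K. v = (\<Oplus>\<^bsub>L\<^esub>s\<in>S. c s \<odot>\<^bsub>L\<^esub> s)))"

definition hom_algebra_hom ::
    "('k, 'm) ring_scheme \<Rightarrow> ('k, 'v) hom_algebra \<Rightarrow> ('k, 'w) hom_algebra \<Rightarrow> ('v \<Rightarrow> 'w) set"
  where "hom_algebra_hom K L M =
    {f \<in> carrier L \<rightarrow> carrier M.
      (\<forall>x\<in>carrier L. \<forall>y\<in>carrier L. f (x \<oplus>\<^bsub>L\<^esub> y) = f x \<oplus>\<^bsub>M\<^esub> f y) \<and>
      (\<forall>c\<in>carrier K. \<forall>x\<in>carrier L. f (c \<odot>\<^bsub>L\<^esub> x) = c \<odot>\<^bsub>M\<^esub> f x) \<and>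
      (\<forall>x\<in>carrier L. \<forall>y\<in>carrier L. f (x \<otimes>\<^bsub>L\<^esub> y) = f x \<otimes>\<^bsub>M\<^esub> f y) \<and>
      (\<forall>x\<in>carrier L. f (twist L x) = twist M (f x))}"

definition hom_algebra_isomorphic ::
    "('k, 'm) ring_scheme \<Rightarrow> ('k, 'v) hom_algebra \<Rightarrow> ('k, 'w) hom_algebra \<Rightarrow> bool"
  where "hom_algebra_isomorphic K L M \<longleftrightarrow>
    (\<exists>f\<in>hom_algebra_hom K L M. bij_betw f (carrier L) (carrier M))"

definition direct_sum ::
    "('k, 'v) hom_algebra \<Rightarrow> ('k, 'w) hom_algebra \<Rightarrow> ('k, 'v \<times> 'w) hom_algebra"
  where "direct_sum L M =
    \<lparr>carrier = carrier L \<times> carrier M,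
     mult = (\<lambda>(x, y) (x', y'). (x \<otimes>\<^bsub>L\<^esub> x', y \<otimes>\<^bsub>M\<^esub> y')),
     one = (\<one>\<^bsub>L\<^esub>, \<one>\<^bsub>M\<^esub>),
     zero = (\<zero>\<^bsub>L\<^esub>, \<zero>\<^bsub>M\<^esub>),
     add = (\<lambda>(x, y) (x', y'). (x \<oplus>\<^bsub>L\<^esub> x', y \<oplus>\<^bsub>M\<^esub> y')),
     smult = (\<lambda>c (x, y). (c \<odot>\<^bsub>L\<^esub> x, c \<odot>\<^bsub>M\<^esub> y)),
     twist = (\<lambda>(x, y). (twist L x, twist M y))\<rparr>"

definition alpha_center :: "('k, 'v) hom_algebra \<Rightarrow> 'v set"
  where "alpha_center L =
    {x \<in> carrier L. \<forall>y\<in>carrier L. \<forall>n.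
      (twist L ^^ n) x \<otimes>\<^bsub>L\<^esub> y = \<zero>\<^bsub>L\<^esub> \<and> y \<otimes>\<^bsub>L\<^esub> (twist L ^^ n) x = \<zero>\<^bsub>L\<^esub>}"

text \<open>
  The quotient by an ideal, on the set of its cosets.  As in \<^const>\<open>FactRing\<close>, the value of an
  operation is the union of the cosets obtained from all representatives, which is a single coset
  because the ideal is stable under the operations.
\<close>

definition quotient_algebra :: "('k, 'v) hom_algebra \<Rightarrow> 'v set \<Rightarrow> ('k, 'v set) hom_algebra"
  where "quotient_algebra L I =
    \<lparr>carrier = a_rcosets\<^bsub>L\<^esub> I,
     mult = rcoset_mult L I,
     one = I +>\<^bsub>L\<^esub> \<one>\<^bsub>L\<^esub>,
     zero = I,
     add = set_add L,
     smult = (\<lambda>c A. \<Union>a\<in>A. I +>\<^bsub>L\<^esub> (c \<odot>\<^bsub>L\<^esub> a)),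
     twist = (\<lambda>A. \<Union>a\<in>A. I +>\<^bsub>L\<^esub> twist L a)\<rparr>"

text \<open>
  Capability of \<open>g\<close> asks for some algebra \<open>k\<close>, of unrestricted size.  HOL cannot quantify over the
  type of the elements of \<open>k\<close>, so \<open>k\<close> is sought among algebras whose elements are formal
  expressions over \<open>g\<close>.  This is no restriction: \<open>capableI\<close> below shows that a witness
  with elements in an arbitrary type yields one of this form.  (Lift the elements of \<open>g\<close> to \<open>k\<close> and
  replace \<open>k\<close> by the subalgebra they generate, all of whose elements are values of expressions.)
\<close>

datatype ('k, 'v) expression =
    Gen 'v
  | Zero
  | Add "('k, 'v) expression" "('k, 'v) expression"
  | Scale 'k "('k, 'v) expression"
  | Bracket "('k, 'v) expression" "('k, 'v) expression"
  | Twist "('k, 'v) expression"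

definition capable :: "('k, 'm) ring_scheme \<Rightarrow> ('k, 'v) hom_algebra \<Rightarrow> bool"
  where "capable K g \<longleftrightarrow>
    (\<exists>k :: ('k, ('k, 'v) expression) hom_algebra.
      hom_leibniz_algebra K k \<and>
      hom_algebra_isomorphic K g (quotient_algebra k (alpha_center k)))"

lemma (in hom_leibniz_algebra) alpha_centerD:
  assumes "x \<in> alpha_center L" "y \<in> carrier L"
  shows "(twist L ^^ n) x \<otimes>\<^bsub>L\<^esub> y = \<zero>\<^bsub>L\<^esub>" "y \<otimes>\<^bsub>L\<^esub> (twist L ^^ n) x = \<zero>\<^bsub>L\<^esub>"
  using assms unfolding alpha_center_def by auto

lemma (in hom_leibniz_algebra) bracket_zero:
  assumes "x \<in> carrier L"
  shows "\<zero>\<^bsub>L\<^esub> \<otimes>\<^bsub>L\<^esub> x = \<zero>\<^bsub>L\<^esub>" "x \<otimes>\<^bsub>L\<^esub> \<zero>\<^bsub>L\<^esub> = \<zero>\<^bsub>L\<^esub>"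
proof -
  show "\<zero>\<^bsub>L\<^esub> \<otimes>\<^bsub>L\<^esub> x = \<zero>\<^bsub>L\<^esub>"
    using bracket_smult_left[of "\<zero>\<^bsub>K\<^esub>" x x] assms bracket_closed by simp
  show "x \<otimes>\<^bsub>L\<^esub> \<zero>\<^bsub>L\<^esub> = \<zero>\<^bsub>L\<^esub>"
    using bracket_smult_right[of "\<zero>\<^bsub>K\<^esub>" x x] assms bracket_closed by simp
qed

lemma (in hom_leibniz_algebra) twist_pow:
  assumes "x \<in> carrier L"
  shows "(twist L ^^ n) x \<in> carrier L"
    and "y \<in> carrier L \<Longrightarrow>
      (twist L ^^ n) (x \<oplus>\<^bsub>L\<^esub> y) = (twist L ^^ n) x \<oplus>\<^bsub>L\<^esub> (twist L ^^ n) y"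
    and "c \<in> carrier K \<Longrightarrow> (twist L ^^ n) (c \<odot>\<^bsub>L\<^esub> x) = c \<odot>\<^bsub>L\<^esub> (twist L ^^ n) x"
proof -
  have cl: "(twist L ^^ n) x \<in> carrier L" if "x \<in> carrier L" for x n
    using that by (induction n) (auto simp: twist_closed)
  show "(twist L ^^ n) x \<in> carrier L" by (rule cl[OF assms])
  show "(twist L ^^ n) (x \<oplus>\<^bsub>L\<^esub> y) = (twist L ^^ n) x \<oplus>\<^bsub>L\<^esub> (twist L ^^ n) y"
    if "y \<in> carrier L"
    using assms that by (induction n) (auto simp: twist_add cl)
  show "(twist L ^^ n) (c \<odot>\<^bsub>L\<^esub> x) = c \<odot>\<^bsub>L\<^esub> (twist L ^^ n) x" if "c \<in> carrier K"
    using assms that by (induction n) (auto simp: twist_smult cl)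
qed

lemma (in hom_leibniz_algebra) alpha_center_submodule: "submodule (alpha_center L) K L"
proof (rule submoduleI)
  show "alpha_center L \<subseteq> carrier L" by (auto simp: alpha_center_def)
  have "(twist L ^^ n) \<zero>\<^bsub>L\<^esub> = \<zero>\<^bsub>L\<^esub>" for n
    using twist_pow(3)[of "\<zero>\<^bsub>L\<^esub>" "\<zero>\<^bsub>K\<^esub>" n] twist_pow(1)[of "\<zero>\<^bsub>L\<^esub>" n] by simp
  then show "\<zero>\<^bsub>L\<^esub> \<in> alpha_center L"
    by (auto simp: alpha_center_def bracket_zero)
  show smult: "c \<odot>\<^bsub>L\<^esub> x \<in> alpha_center L" if "c \<in> carrier K" "x \<in> alpha_center L" for c x
    using that by (auto simp: alpha_center_def twist_pow bracket_smult_left bracket_smult_right)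
  show "x \<oplus>\<^bsub>L\<^esub> y \<in> alpha_center L" if "x \<in> alpha_center L" "y \<in> alpha_center L" for x y
    using that by (auto simp: alpha_center_def twist_pow bracket_add_left bracket_add_right)
  show "\<ominus>\<^bsub>L\<^esub> x \<in> alpha_center L" if "x \<in> alpha_center L" for x
  proof -
    have "x \<in> carrier L" using that by (auto simp: alpha_center_def)
    then have "\<ominus>\<^bsub>L\<^esub> x = (\<ominus>\<^bsub>K\<^esub> \<one>\<^bsub>K\<^esub>) \<odot>\<^bsub>L\<^esub> x" by (simp add: smult_l_minus)
    then show ?thesis using smult[OF _ that] by simp
  qed
qed

lemma (in hom_leibniz_algebra) alpha_center_ideal:
  assumes "x \<in> alpha_center L" "y \<in> carrier L"
  shows "twist L x \<in> alpha_center L"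
    and "x \<otimes>\<^bsub>L\<^esub> y = \<zero>\<^bsub>L\<^esub>" and "y \<otimes>\<^bsub>L\<^esub> x = \<zero>\<^bsub>L\<^esub>"
proof -
  show "x \<otimes>\<^bsub>L\<^esub> y = \<zero>\<^bsub>L\<^esub>" "y \<otimes>\<^bsub>L\<^esub> x = \<zero>\<^bsub>L\<^esub>"
    using alpha_centerD[OF assms, of 0] by auto
  have "(twist L ^^ n) (twist L x) = (twist L ^^ Suc n) x" for n
    by (simp add: funpow_swap1)
  then show "twist L x \<in> alpha_center L"
    using assms alpha_centerD[OF assms(1), of _ "Suc _"]
    by (auto simp: alpha_center_def twist_closed simp del: funpow.simps)
qed

lemma (in hom_leibniz_algebra) alpha_center_abelian_subgroup: "abelian_subgroup (alpha_center L) L"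
  using alpha_center_submodule
  by (intro abelian_subgroupI3) (auto simp: additive_subgroup_def submodule_def abelian_group_axioms)

lemma (in hom_leibniz_algebra) coset_alpha_center_eq_iff:
  assumes "x \<in> carrier L" "y \<in> carrier L"
  shows "alpha_center L +>\<^bsub>L\<^esub> x = alpha_center L +>\<^bsub>L\<^esub> y \<longleftrightarrow> x \<ominus>\<^bsub>L\<^esub> y \<in> alpha_center L"
proof -
  interpret A: abelian_subgroup "alpha_center L" L by (rule alpha_center_abelian_subgroup)
  have "x \<in> alpha_center L +>\<^bsub>L\<^esub> y \<longleftrightarrow> x \<ominus>\<^bsub>L\<^esub> y \<in> alpha_center L"
    using A.a_rcos_module[of y x] assms by (simp add: a_minus_def)
  then show ?thesis
    using A.a_rcos_self[of x] A.a_repr_independence'[of x y] assms by auto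
qed

text \<open>The operations of the quotient by the \<open>\<alpha>\<close>-center are the induced ones.\<close>

lemma (in hom_leibniz_algebra) quotient_algebra_simps:
  fixes Z Q
  defines "Z \<equiv> alpha_center L" and "Q \<equiv> quotient_algebra L (alpha_center L)"
  shows "carrier Q = (\<lambda>x. Z +>\<^bsub>L\<^esub> x) ` carrier L"
    and "x \<in> carrier L \<Longrightarrow> y \<in> carrier L \<Longrightarrow>
      (Z +>\<^bsub>L\<^esub> x) \<oplus>\<^bsub>Q\<^esub> (Z +>\<^bsub>L\<^esub> y) = Z +>\<^bsub>L\<^esub> (x \<oplus>\<^bsub>L\<^esub> y)"
    and "x \<in> carrier L \<Longrightarrow> y \<in> carrier L \<Longrightarrow>
      (Z +>\<^bsub>L\<^esub> x) \<otimes>\<^bsub>Q\<^esub> (Z +>\<^bsub>L\<^esub> y) = Z +>\<^bsub>L\<^esub> (x \<otimes>\<^bsub>L\<^esub> y)"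
    and "c \<in> carrier K \<Longrightarrow> x \<in> carrier L \<Longrightarrow>
      c \<odot>\<^bsub>Q\<^esub> (Z +>\<^bsub>L\<^esub> x) = Z +>\<^bsub>L\<^esub> (c \<odot>\<^bsub>L\<^esub> x)"
    and "x \<in> carrier L \<Longrightarrow> twist Q (Z +>\<^bsub>L\<^esub> x) = Z +>\<^bsub>L\<^esub> twist L x"
proof -
  have sub: "Z \<subseteq> carrier L" by (auto simp: Z_def alpha_center_def)
  interpret A: abelian_subgroup "alpha_center L" L by (rule alpha_center_abelian_subgroup)
  have cong: "\<exists>z\<in>Z. u = z \<oplus>\<^bsub>L\<^esub> x" if "u \<in> Z +>\<^bsub>L\<^esub> x" for u x
    using that by (auto simp: a_r_coset_def')
  have absorb: "Z +>\<^bsub>L\<^esub> (z \<oplus>\<^bsub>L\<^esub> x) = Z +>\<^bsub>L\<^esub> x" if "z \<in> Z" "x \<in> carrier L" for z x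
  proof -
    have "z \<oplus>\<^bsub>L\<^esub> x \<in> Z +>\<^bsub>L\<^esub> x" using that(1) by (auto simp: a_r_coset_def')
    then show ?thesis
      using A.a_repr_independence'[of "z \<oplus>\<^bsub>L\<^esub> x" x] that(2) unfolding Z_def by simp
  qed
  have Un: "(\<Union>a\<in>A. F a) = D" if "x \<in> A" "\<And>a. a \<in> A \<Longrightarrow> F a = D"
    for A D and F :: "'c \<Rightarrow> 'd set" and x
    using that by auto
  have self: "x \<in> Z +>\<^bsub>L\<^esub> x" if "x \<in> carrier L" for x
    using A.a_rcos_self[OF that] by (simp add: Z_def)
  show "carrier Q = (\<lambda>x. Z +>\<^bsub>L\<^esub> x) ` carrier L"
    by (auto simp: Q_def Z_def quotient_algebra_def A_RCOSETS_def')
  show "(Z +>\<^bsub>L\<^esub> x) \<oplus>\<^bsub>Q\<^esub> (Z +>\<^bsub>L\<^esub> y) = Z +>\<^bsub>L\<^esub> (x \<oplus>\<^bsub>L\<^esub> y)"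
    if "x \<in> carrier L" "y \<in> carrier L"
    using A.a_rcos_sum[OF that] by (simp add: Q_def Z_def quotient_algebra_def)
  show "(Z +>\<^bsub>L\<^esub> x) \<otimes>\<^bsub>Q\<^esub> (Z +>\<^bsub>L\<^esub> y) = Z +>\<^bsub>L\<^esub> (x \<otimes>\<^bsub>L\<^esub> y)"
    if xy: "x \<in> carrier L" "y \<in> carrier L"
  proof -
    have "u \<otimes>\<^bsub>L\<^esub> v = x \<otimes>\<^bsub>L\<^esub> y" if uv: "u \<in> Z +>\<^bsub>L\<^esub> x" "v \<in> Z +>\<^bsub>L\<^esub> y" for u v
    proof -
      obtain z w where "z \<in> Z" "u = z \<oplus>\<^bsub>L\<^esub> x" "w \<in> Z" "v = w \<oplus>\<^bsub>L\<^esub> y"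
        using cong[OF uv(1)] cong[OF uv(2)] by blast
      then show ?thesis
        using xy sub alpha_center_ideal(2,3)
        by (auto simp: Z_def bracket_add_left bracket_add_right bracket_closed subset_iff)
    qed
    then have "rcoset_mult L Z (Z +>\<^bsub>L\<^esub> x) (Z +>\<^bsub>L\<^esub> y) = Z +>\<^bsub>L\<^esub> (x \<otimes>\<^bsub>L\<^esub> y)"
      unfolding rcoset_mult_def
      by (intro Un[OF self[OF xy(1)]] Un[OF self[OF xy(2)]]) (simp only:)
    then show ?thesis by (simp add: Q_def Z_def quotient_algebra_def)
  qed
  show "c \<odot>\<^bsub>Q\<^esub> (Z +>\<^bsub>L\<^esub> x) = Z +>\<^bsub>L\<^esub> (c \<odot>\<^bsub>L\<^esub> x)" if cx: "c \<in> carrier K" "x \<in> carrier L"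
  proof -
    have "Z +>\<^bsub>L\<^esub> (c \<odot>\<^bsub>L\<^esub> u) = Z +>\<^bsub>L\<^esub> (c \<odot>\<^bsub>L\<^esub> x)" if "u \<in> Z +>\<^bsub>L\<^esub> x" for u
    proof -
      obtain z where "z \<in> Z" "u = z \<oplus>\<^bsub>L\<^esub> x" using cong[OF \<open>u \<in> _\<close>] by auto
      moreover have "c \<odot>\<^bsub>L\<^esub> z \<in> Z"
        using submodule.smult_closed[OF alpha_center_submodule cx(1)] \<open>z \<in> Z\<close> by (simp add: Z_def)
      ultimately show ?thesis
        using absorb[of "c \<odot>\<^bsub>L\<^esub> z" "c \<odot>\<^bsub>L\<^esub> x"] cx sub
        by (auto simp: smult_r_distr subset_iff)
    qed
    then have "(\<Union>u\<in>Z +>\<^bsub>L\<^esub> x. Z +>\<^bsub>L\<^esub> (c \<odot>\<^bsub>L\<^esub> u)) = Z +>\<^bsub>L\<^esub> (c \<odot>\<^bsub>L\<^esub> x)"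
      by (rule Un[OF self[OF cx(2)]])
    then show ?thesis by (simp add: Q_def Z_def quotient_algebra_def)
  qed
  show "twist Q (Z +>\<^bsub>L\<^esub> x) = Z +>\<^bsub>L\<^esub> twist L x" if x: "x \<in> carrier L"
  proof -
    have "Z +>\<^bsub>L\<^esub> twist L u = Z +>\<^bsub>L\<^esub> twist L x" if "u \<in> Z +>\<^bsub>L\<^esub> x" for u
    proof -
      obtain z where z: "z \<in> Z" "u = z \<oplus>\<^bsub>L\<^esub> x" using cong[OF \<open>u \<in> _\<close>] by auto
      moreover have "twist L z \<in> Z"
        using alpha_center_ideal(1)[OF _ x] z by (simp add: Z_def)
      ultimately show ?thesis
        using absorb[of "twist L z" "twist L x"] x sub
        by (auto simp: twist_add twist_closed subset_iff)
    qed
    then have "(\<Union>u\<in>Z +>\<^bsub>L\<^esub> x. Z +>\<^bsub>L\<^esub> twist L u) = Z +>\<^bsub>L\<^esub> twist L x"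
      by (rule Un[OF self[OF x]])
    then show ?thesis by (simp add: Q_def Z_def quotient_algebra_def)
  qed
qed

lemma isomorphic_quotient_iff:
  assumes "hom_leibniz_algebra K g" and "hom_leibniz_algebra K k"
  shows "hom_algebra_isomorphic K g (quotient_algebra k (alpha_center k)) \<longleftrightarrow>
    (\<exists>f\<in>hom_algebra_hom K k g. f ` carrier k = carrier g \<and>
      (\<forall>x\<in>carrier k. \<forall>y\<in>carrier k. f x = f y \<longleftrightarrow> x \<ominus>\<^bsub>k\<^esub> y \<in> alpha_center k))"
    (is "?iso \<longleftrightarrow> ?epi")
proof
  interpret g: hom_leibniz_algebra K g by fact
  interpret k: hom_leibniz_algebra K k by fact
  let ?Q = "quotient_algebra k (alpha_center k)" and ?c = "\<lambda>x. alpha_center k +>\<^bsub>k\<^esub> x"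
  note Q = k.quotient_algebra_simps and eq = k.coset_alpha_center_eq_iff
  {
    assume ?iso
    then obtain h where h: "h \<in> hom_algebra_hom K g ?Q" "bij_betw h (carrier g) (carrier ?Q)"
      unfolding hom_algebra_isomorphic_def by auto
    define f where "f = (\<lambda>x. inv_into (carrier g) h (?c x))"
    have hf: "h (f x) = ?c x" and f: "f x \<in> carrier g" if "x \<in> carrier k" for x
    proof -
      have "?c x \<in> h ` carrier g"
        using bij_betw_imp_surj_on[OF h(2)] that by (simp add: Q(1))
      then show "h (f x) = ?c x" "f x \<in> carrier g"
        unfolding f_def by (simp_all add: f_inv_into_f inv_into_into)
    qed
    have fI: "f x = a" if "x \<in> carrier k" "a \<in> carrier g" "h a = ?c x" for x a
      using bij_betw_imp_inj_on[OF h(2)] hf[OF that(1)] f[OF that(1)] that by (auto dest: inj_onD)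
    have hom: "f \<in> hom_algebra_hom K k g"
      using h(1) unfolding hom_algebra_hom_def
      by (auto intro!: fI simp: f hf Q(2-) k.bracket_closed k.twist_closed g.bracket_closed g.twist_closed)
    have "a \<in> f ` carrier k" if "a \<in> carrier g" for a
    proof -
      have "h a \<in> carrier ?Q" using bij_betwE[OF h(2)] that by auto
      then obtain x where "x \<in> carrier k" "h a = ?c x" by (auto simp: Q(1))
      then show ?thesis using fI[OF _ that] by blast
    qed
    then have "f ` carrier k = carrier g" using f by auto
    moreover have "f x = f y \<longleftrightarrow> x \<ominus>\<^bsub>k\<^esub> y \<in> alpha_center k"
      if "x \<in> carrier k" "y \<in> carrier k" for x y
      using fI[of x "f y"] hf[of x] hf[of y] f[of y] that eq[of x y] by metis
    ultimately show ?epi using hom by blast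
  }
  {
    assume ?epi
    then obtain f where f: "f \<in> hom_algebra_hom K k g" "f ` carrier k = carrier g"
      and ker: "\<And>x y. x \<in> carrier k \<Longrightarrow> y \<in> carrier k \<Longrightarrow>
        f x = f y \<longleftrightarrow> x \<ominus>\<^bsub>k\<^esub> y \<in> alpha_center k"
      by blast
    define h where "h = (\<lambda>a. ?c (inv_into (carrier k) f a))"
    have hf: "h (f x) = ?c x" if "x \<in> carrier k" for x
    proof -
      have "f x \<in> f ` carrier k" using that by simp
      then have "inv_into (carrier k) f (f x) \<in> carrier k"
        "f (inv_into (carrier k) f (f x)) = f x"
        by (simp_all only: inv_into_into f_inv_into_f)
      then show ?thesis unfolding h_def using ker eq that by metis
    qed
    have f_hom: "f (x \<oplus>\<^bsub>k\<^esub> y) = f x \<oplus>\<^bsub>g\<^esub> f y" "f (x \<otimes>\<^bsub>k\<^esub> y) = f x \<otimes>\<^bsub>g\<^esub> f y"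
      "f (twist k x) = twist g (f x)" "c \<in> carrier K \<Longrightarrow> f (c \<odot>\<^bsub>k\<^esub> x) = c \<odot>\<^bsub>g\<^esub> f x"
      if "x \<in> carrier k" "y \<in> carrier k" for x y c
      using f(1) that unfolding hom_algebra_hom_def by auto
    have "h (f x \<oplus>\<^bsub>g\<^esub> f y) = h (f x) \<oplus>\<^bsub>?Q\<^esub> h (f y)" "h (f x \<otimes>\<^bsub>g\<^esub> f y) = h (f x) \<otimes>\<^bsub>?Q\<^esub> h (f y)"
      "h (twist g (f x)) = twist ?Q (h (f x))"
      "c \<in> carrier K \<Longrightarrow> h (c \<odot>\<^bsub>g\<^esub> f x) = c \<odot>\<^bsub>?Q\<^esub> h (f x)"
      if "x \<in> carrier k" "y \<in> carrier k" for x y c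
      using that f_hom[of x y, symmetric]
      by (simp_all add: hf Q(2-) k.bracket_closed k.twist_closed)
    then have "h \<in> hom_algebra_hom K g ?Q"
      using hf unfolding hom_algebra_hom_def f(2)[symmetric] by (auto simp: Q(1))
    moreover have "bij_betw h (carrier g) (carrier ?Q)"
      unfolding f(2)[symmetric] Q(1) bij_betw_def
      using hf ker eq by (auto simp: inj_on_def image_image)
    ultimately show ?iso unfolding hom_algebra_isomorphic_def by blast
  }
qed

text \<open>Witnesses for capability may have elements of any type \<open>'w\<close>.\<close>

lemma capableI:
  fixes g :: "('k, 'v) hom_algebra" and k :: "('k, 'w) hom_algebra"
  assumes g: "hom_leibniz_algebra K g" and k: "hom_leibniz_algebra K k"
    and iso: "hom_algebra_isomorphic K g (quotient_algebra k (alpha_center k))"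
  shows "capable K g"
proof -
  interpret g: hom_leibniz_algebra K g by (fact g)
  interpret k: hom_leibniz_algebra K k by (fact k)
  obtain f where f: "f \<in> hom_algebra_hom K k g" "f ` carrier k = carrier g"
    and ker: "\<And>x y. x \<in> carrier k \<Longrightarrow> y \<in> carrier k \<Longrightarrow>
      f x = f y \<longleftrightarrow> x \<ominus>\<^bsub>k\<^esub> y \<in> alpha_center k"
    using iso unfolding isomorphic_quotient_iff[OF g k] by blast
  define ev :: "('k, 'v) expression \<Rightarrow> 'w"
    where "ev = rec_expression
      (\<lambda>a. if a \<in> carrier g then inv_into (carrier k) f a else \<zero>\<^bsub>k\<^esub>) \<zero>\<^bsub>k\<^esub>
      (\<lambda>_ _ x y. x \<oplus>\<^bsub>k\<^esub> y) (\<lambda>c _ x. if c \<in> carrier K then c \<odot>\<^bsub>k\<^esub> x else \<zero>\<^bsub>k\<^esub>)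
      (\<lambda>_ _ x y. x \<otimes>\<^bsub>k\<^esub> y) (\<lambda>_ x. twist k x)"
  have ev_simps: "ev (Gen a) = (if a \<in> carrier g then inv_into (carrier k) f a else \<zero>\<^bsub>k\<^esub>)"
    "ev Zero = \<zero>\<^bsub>k\<^esub>" "ev (Add d e) = ev d \<oplus>\<^bsub>k\<^esub> ev e"
    "ev (Scale c e) = (if c \<in> carrier K then c \<odot>\<^bsub>k\<^esub> ev e else \<zero>\<^bsub>k\<^esub>)"
    "ev (Bracket d e) = ev d \<otimes>\<^bsub>k\<^esub> ev e" "ev (Twist e) = twist k (ev e)" for a c d e
    by (simp_all add: ev_def)
  have ev: "ev e \<in> carrier k" for e
    by (induction e)
      (auto simp: ev_simps k.bracket_closed k.twist_closed f(2)[symmetric] inv_into_into)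
  define rep where "rep e = (SOME d. ev d = ev e)" for e
  have ev_rep [simp]: "ev (rep e) = ev e" for e
    unfolding rep_def by (rule someI[of _ e]) simp
  have rep_eq: "rep d = rep e" if "ev d = ev e" for d e
    unfolding rep_def that ..
  define k' :: "('k, ('k, 'v) expression) hom_algebra"
    where "k' = \<lparr>carrier = range rep, mult = (\<lambda>d e. rep (Bracket d e)), one = Zero,
      zero = rep Zero, add = (\<lambda>d e. rep (Add d e)), smult = (\<lambda>c e. rep (Scale c e)),
      twist = (\<lambda>e. rep (Twist e))\<rparr>"
  have k'_simps: "carrier k' = range rep" "d \<otimes>\<^bsub>k'\<^esub> e = rep (Bracket d e)" "\<zero>\<^bsub>k'\<^esub> = rep Zero"
    "d \<oplus>\<^bsub>k'\<^esub> e = rep (Add d e)" "c \<odot>\<^bsub>k'\<^esub> e = rep (Scale c e)" "twist k' e = rep (Twist e)"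
    for c d e by (simp_all add: k'_def)
  have eqI: "d = e" if de: "d \<in> carrier k'" "e \<in> carrier k'" "ev d = ev e" for d e
  proof -
    obtain d' e' where "d = rep d'" "e = rep e'" using de(1,2) by (auto simp: k'_simps)
    then show ?thesis using de(3) rep_eq[of d' e'] by simp
  qed
  have closed: "rep e \<in> carrier k'" for e by (simp add: k'_simps)
  have ev_hom: "ev (d \<otimes>\<^bsub>k'\<^esub> e) = ev d \<otimes>\<^bsub>k\<^esub> ev e" "ev \<zero>\<^bsub>k'\<^esub> = \<zero>\<^bsub>k\<^esub>"
    "ev (d \<oplus>\<^bsub>k'\<^esub> e) = ev d \<oplus>\<^bsub>k\<^esub> ev e" "c \<in> carrier K \<Longrightarrow> ev (c \<odot>\<^bsub>k'\<^esub> e) = c \<odot>\<^bsub>k\<^esub> ev e"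
    "ev (twist k' e) = twist k (ev e)" for c d e
    by (simp_all add: k'_simps ev_simps)
  have k'_closed: "d \<otimes>\<^bsub>k'\<^esub> e \<in> carrier k'" "\<zero>\<^bsub>k'\<^esub> \<in> carrier k'" "d \<oplus>\<^bsub>k'\<^esub> e \<in> carrier k'"
    "c \<odot>\<^bsub>k'\<^esub> e \<in> carrier k'" "twist k' e \<in> carrier k'" for c d e
    by (simp_all add: k'_simps)
  have ag: "abelian_group k'"
  proof (rule abelian_groupI)
    show "\<exists>d\<in>carrier k'. d \<oplus>\<^bsub>k'\<^esub> e = \<zero>\<^bsub>k'\<^esub>" if "e \<in> carrier k'" for e
      by (rule bexI[of _ "(\<ominus>\<^bsub>K\<^esub> \<one>\<^bsub>K\<^esub>) \<odot>\<^bsub>k'\<^esub> e"], rule eqI)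
        (simp_all add: k'_closed ev_hom ev k.smult_l_minus k.l_neg)
  qed (auto intro!: eqI simp: k'_closed ev_hom ev k.a_ac)
  have "module K k'"
    using ag module.axioms(1)[OF k.module_axioms]
    by (auto intro!: moduleI eqI
      simp: k'_closed ev_hom ev k.smult_l_distr k.smult_r_distr k.smult_assoc1)
  then interpret m: module K k' .
  have ev_minus: "ev (d \<ominus>\<^bsub>k'\<^esub> e) = ev d \<ominus>\<^bsub>k\<^esub> ev e" if "d \<in> carrier k'" "e \<in> carrier k'" for d e
  proof -
    have "d \<ominus>\<^bsub>k'\<^esub> e = d \<oplus>\<^bsub>k'\<^esub> (\<ominus>\<^bsub>K\<^esub> \<one>\<^bsub>K\<^esub>) \<odot>\<^bsub>k'\<^esub> e"
      using that by (simp add: m.smult_l_minus a_minus_def)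
    then show ?thesis by (simp add: ev_hom ev k.smult_l_minus a_minus_def)
  qed
  have k': "hom_leibniz_algebra K k'"
    by (intro hom_leibniz_algebra.intro hom_leibniz_algebra_axioms.intro
        hom_leibniz_algebra.axioms(1)[OF k] \<open>module K k'\<close>)
      (auto intro!: eqI simp: k'_closed ev_hom ev ev_minus m.minus_closed
        k.bracket_add_left k.bracket_add_right k.bracket_smult_left k.bracket_smult_right
        k.twist_add k.twist_smult k.twist_bracket k.hom_leibniz_identity)
  have ev_pow: "ev ((twist k' ^^ n) e) = (twist k ^^ n) (ev e)"
    and pow_closed: "e \<in> carrier k' \<Longrightarrow> (twist k' ^^ n) e \<in> carrier k'" for n e
    by (induction n) (auto simp: ev_hom k'_closed)
  have f_closed: "f x \<in> carrier g" if "x \<in> carrier k" for x using f(2) that by blast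
  have f_ev_Gen: "f (ev (rep (Gen a))) = a" if "a \<in> carrier g" for a
    using that f(2) by (simp add: ev_simps f_inv_into_f)
  have center: "e \<in> alpha_center k' \<longleftrightarrow> ev e \<in> alpha_center k" if e: "e \<in> carrier k'" for e
  proof
    assume c: "ev e \<in> alpha_center k"
    have "(twist k' ^^ n) e \<otimes>\<^bsub>k'\<^esub> d = \<zero>\<^bsub>k'\<^esub>" "d \<otimes>\<^bsub>k'\<^esub> (twist k' ^^ n) e = \<zero>\<^bsub>k'\<^esub>"
      for d n
      by (rule eqI; simp add: k'_closed ev_hom ev_pow k.alpha_centerD[OF c ev])+
    then show "e \<in> alpha_center k'" using e by (simp add: alpha_center_def)
  next
    assume c: "e \<in> alpha_center k'"
    have "(twist k ^^ n) (ev e) \<otimes>\<^bsub>k\<^esub> y = \<zero>\<^bsub>k\<^esub> \<and> y \<otimes>\<^bsub>k\<^esub> (twist k ^^ n) (ev e) = \<zero>\<^bsub>k\<^esub>"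
      if y: "y \<in> carrier k" for y n
    proof -
      define d where "d = rep (Gen (f y))"
      define z where "z = y \<ominus>\<^bsub>k\<^esub> ev d"
      have "f y = f (ev d)" using f_ev_Gen[of "f y"] f_closed[OF y] by (simp add: d_def)
      then have z: "z \<in> alpha_center k" using ker[OF y ev] by (simp add: z_def)
      have zc: "z \<in> carrier k" using y ev by (simp add: z_def)
      have y_eq: "y = z \<oplus>\<^bsub>k\<^esub> ev d"
        using y ev[of d] by (simp add: z_def a_minus_def k.a_assoc k.l_neg)
      let ?x = "(twist k' ^^ n) e"
      have "d \<in> carrier k'" by (simp add: d_def closed)
      then have "?x \<otimes>\<^bsub>k'\<^esub> d = \<zero>\<^bsub>k'\<^esub>" "d \<otimes>\<^bsub>k'\<^esub> ?x = \<zero>\<^bsub>k'\<^esub>"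
        using c by (auto simp: alpha_center_def)
      then have "ev ?x \<otimes>\<^bsub>k\<^esub> ev d = \<zero>\<^bsub>k\<^esub>" "ev d \<otimes>\<^bsub>k\<^esub> ev ?x = \<zero>\<^bsub>k\<^esub>"
        by (metis ev_hom(1,2))+
      moreover have "ev ?x \<otimes>\<^bsub>k\<^esub> z = \<zero>\<^bsub>k\<^esub>" "z \<otimes>\<^bsub>k\<^esub> ev ?x = \<zero>\<^bsub>k\<^esub>"
        using k.alpha_center_ideal(2,3)[OF z ev] by auto
      ultimately have "ev ?x \<otimes>\<^bsub>k\<^esub> y = \<zero>\<^bsub>k\<^esub> \<and> y \<otimes>\<^bsub>k\<^esub> ev ?x = \<zero>\<^bsub>k\<^esub>"
        unfolding y_eq using zc ev by (simp add: k.bracket_add_left k.bracket_add_right)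
      then show ?thesis by (simp add: ev_pow)
    qed
    then show "ev e \<in> alpha_center k" by (simp add: alpha_center_def ev)
  qed
  have "(f \<circ> ev) \<in> hom_algebra_hom K k' g"
    using f(1) ev unfolding hom_algebra_hom_def by (auto simp: ev_hom)
  moreover have "(f \<circ> ev) ` carrier k' = carrier g"
  proof
    show "(f \<circ> ev) ` carrier k' \<subseteq> carrier g" using ev f_closed by auto
    show "carrier g \<subseteq> (f \<circ> ev) ` carrier k'"
      using f_ev_Gen closed by (metis comp_apply imageI subsetI)
  qed
  moreover have "(f \<circ> ev) d = (f \<circ> ev) e \<longleftrightarrow> d \<ominus>\<^bsub>k'\<^esub> e \<in> alpha_center k'"
    if "d \<in> carrier k'" "e \<in> carrier k'" for d e
    using ker[OF ev ev] that by (simp add: center ev_minus m.minus_closed)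
  ultimately have "hom_algebra_isomorphic K g (quotient_algebra k' (alpha_center k'))"
    unfolding isomorphic_quotient_iff[OF g k'] by blast
  with k' show ?thesis unfolding capable_def by blast
qed

end

theory Submission
  imports Defs
begin

text \<open>
  Let \<open>k\<close> be a witness for the capability of \<open>g = g1 \<oplus> g2\<close>: an epimorphism \<open>(p, q)\<close> from \<open>k\<close> onto
  \<open>g1 \<oplus> g2\<close> with kernel \<open>Z = Z\<^sub>\<alpha>(k)\<close>.  Put \<open>k1 = ker q\<close> and \<open>k2 = ker p\<close>, so that \<open>k = k1 + k2\<close> and
  \<open>k1 \<inter> k2 = Z\<close>.  The map \<open>p\<close> sends \<open>k1\<close> onto \<open>g1\<close> with kernel \<open>Z\<close>, but \<open>k1\<close> itself may fail to be
  a witness for \<open>g1\<close>: its \<open>\<alpha>\<close>-center can be larger than \<open>Z\<close>, because it may contain elements that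
  commute with \<open>k1\<close> and not with \<open>k2\<close>.

  Two observations repair this.  First, \<open>[k1,k1]\<close> commutes with \<open>k2\<close>.  Indeed
  \<open>[k1,k2] + [k2,k1] \<subseteq> Z\<close> is annihilated by all brackets, so the Hom-Leibniz identity gives
  \<open>[\<alpha>(y),[a,b]] = 0\<close> and \<open>[[a,b],\<alpha>(y)] = 0\<close> for \<open>a, b \<in> k1\<close> and \<open>y \<in> k2\<close>; regularity makes \<open>\<alpha>\<close>
  surjective on \<open>g2\<close>, hence \<open>k2 = \<alpha>(k2) + Z\<close>.  Consequently every element of \<open>Z\<^sub>\<alpha>(k1)\<close> that is
  not in \<open>Z\<close> has an iterated twist outside the centralizer of \<open>k2\<close>, in particular outside
  \<open>[k1,k1] + Z\<close>.

  Second, an element outside \<open>[k1,k1] + Z\<close> can be made non-central without changing the quotient.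
  Any bilinear map on \<open>k1/([k1,k1] + Z)\<close> may be added to the bracket of \<open>k1\<close> as a new central
  component: all terms of the Hom-Leibniz identity vanish on it.  For the map whose \<open>\<phi>\<close>-component is
  \<open>(x, y) \<mapsto> \<phi>(x) \<phi>(y)\<close>, with \<open>\<phi>\<close> ranging over all linear functionals on this quotient, every
  \<open>x \<notin> [k1,k1] + Z\<close> pairs nontrivially with itself, and precomposition with \<open>\<alpha>\<close> is a compatible
  self-map of the new component.  The extended algebra (\<open>square_extension\<close>) has \<open>\<alpha>\<close>-center
  \<open>Z\<close> times the new component (\<open>alpha_center_square_extension\<close>), so its quotient is \<open>g1\<close>
  (\<open>capable_first_factor\<close>).  Exchanging the roles of \<open>g1\<close> and \<open>g2\<close> gives the second summand.
\<close>

section \<open>Linear functionals\<close>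

definition linear_functionals ::
    "('k, 'm) ring_scheme \<Rightarrow> ('k, 'v, 'n) module_scheme \<Rightarrow> ('v \<Rightarrow> 'k) set"
  where "linear_functionals K M =
    {\<phi> \<in> carrier M \<rightarrow> carrier K.
      (\<forall>x\<in>carrier M. \<forall>y\<in>carrier M. \<phi> (x \<oplus>\<^bsub>M\<^esub> y) = \<phi> x \<oplus>\<^bsub>K\<^esub> \<phi> y) \<and>
      (\<forall>c\<in>carrier K. \<forall>x\<in>carrier M. \<phi> (c \<odot>\<^bsub>M\<^esub> x) = c \<otimes>\<^bsub>K\<^esub> \<phi> x)}"

lemma (in abelian_group) minus_zero_eq: "\<ominus> \<zero> = \<zero>"
  using r_neg[OF zero_closed] by simp

lemma (in abelian_group) minus_eq_zero_iff:
  assumes "x \<in> carrier G" "y \<in> carrier G"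
  shows "x \<ominus> y = \<zero> \<longleftrightarrow> x = y"
  using assms by (metis a_inv_closed a_minus_def minus_equality minus_minus r_neg)

lemma (in module) minus_eq_add_smult:
  assumes "x \<in> carrier M" "y \<in> carrier M"
  shows "x \<ominus>\<^bsub>M\<^esub> y = x \<oplus>\<^bsub>M\<^esub> (\<ominus> \<one>) \<odot>\<^bsub>M\<^esub> y"
  using assms by (simp add: smult_l_minus a_minus_def)

lemma (in module) submodule_minus:
  assumes "submodule T R M" "x \<in> T" "y \<in> T"
  shows "x \<ominus>\<^bsub>M\<^esub> y \<in> T"
  using submoduleE[OF assms(1)] assms(2,3) by (simp add: a_minus_def)

lemma (in module) submodule_zero:
  assumes "submodule T R M"
  shows "\<zero>\<^bsub>M\<^esub> \<in> T"
  using submodule.axioms(1)[OF assms] subgroup.one_closed by fastforce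

lemma (in module) Union_chain_submodule:
  assumes "C \<noteq> {}" and sub: "\<And>T. T \<in> C \<Longrightarrow> submodule T R M"
    and chain: "\<And>S T. S \<in> C \<Longrightarrow> T \<in> C \<Longrightarrow> S \<subseteq> T \<or> T \<subseteq> S"
  shows "submodule (\<Union>C) R M"
proof (rule submoduleI)
  show "\<Union>C \<subseteq> carrier M" using submoduleE(1)[OF sub] by blast
  show "\<zero>\<^bsub>M\<^esub> \<in> \<Union>C" using submodule_zero[OF sub] assms(1) by blast
  show "\<ominus>\<^bsub>M\<^esub> a \<in> \<Union>C" if "a \<in> \<Union>C" for a
    using that submoduleE(3)[OF sub] by blast
  show "c \<odot>\<^bsub>M\<^esub> a \<in> \<Union>C" if "c \<in> carrier R" "a \<in> \<Union>C" for c a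
    using that submoduleE(4)[OF sub] by blast
  show "a \<oplus>\<^bsub>M\<^esub> b \<in> \<Union>C" if ab: "a \<in> \<Union>C" "b \<in> \<Union>C" for a b
  proof -
    obtain S T where ST: "S \<in> C" "a \<in> S" "T \<in> C" "b \<in> T" using ab by blast
    then show ?thesis
      using chain[OF ST(1,3)] submoduleE(5)[OF sub[OF ST(1)], of a b]
        submoduleE(5)[OF sub[OF ST(3)], of a b] by blast
  qed
qed

lemma (in module) submodule_add_line:
  assumes T: "submodule T R M" and y: "y \<in> carrier M"
  shows "submodule {t \<oplus>\<^bsub>M\<^esub> c \<odot>\<^bsub>M\<^esub> y | t c. t \<in> T \<and> c \<in> carrier R} R M" (is "submodule ?U R M")
proof -
  note Tc = submoduleE(1)[OF T, THEN subsetD] and E = submoduleE(3-5)[OF T]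
  have smult: "c \<odot>\<^bsub>M\<^esub> u \<in> ?U" if c: "c \<in> carrier R" and uU: "u \<in> ?U" for c u
  proof -
    obtain t d where u: "u = t \<oplus>\<^bsub>M\<^esub> d \<odot>\<^bsub>M\<^esub> y" "t \<in> T" "d \<in> carrier R" using uU by blast
    have "c \<odot>\<^bsub>M\<^esub> u = c \<odot>\<^bsub>M\<^esub> t \<oplus>\<^bsub>M\<^esub> (c \<otimes> d) \<odot>\<^bsub>M\<^esub> y"
      using u y Tc c by (simp add: smult_r_distr smult_assoc1)
    then show ?thesis using u c E by blast
  qed
  show ?thesis
  proof (rule submoduleI)
    show sub: "?U \<subseteq> carrier M" using y Tc by blast
    have "\<zero>\<^bsub>M\<^esub> = \<zero>\<^bsub>M\<^esub> \<oplus>\<^bsub>M\<^esub> \<zero> \<odot>\<^bsub>M\<^esub> y" using y by simp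
    then show "\<zero>\<^bsub>M\<^esub> \<in> ?U" using submodule_zero[OF T] by blast
    show "c \<odot>\<^bsub>M\<^esub> u \<in> ?U" if "c \<in> carrier R" "u \<in> ?U" for c u by (rule smult[OF that])
    show "\<ominus>\<^bsub>M\<^esub> u \<in> ?U" if u: "u \<in> ?U" for u
    proof -
      have "\<ominus>\<^bsub>M\<^esub> u = (\<ominus> \<one>) \<odot>\<^bsub>M\<^esub> u" using subsetD[OF sub u] by (simp add: smult_l_minus)
      then show ?thesis using smult[OF _ u, of "\<ominus> \<one>"] by simp
    qed
    show "u \<oplus>\<^bsub>M\<^esub> v \<in> ?U" if uU: "u \<in> ?U" and vU: "v \<in> ?U" for u v
    proof -
      obtain s c t d where uv: "u = s \<oplus>\<^bsub>M\<^esub> c \<odot>\<^bsub>M\<^esub> y" "s \<in> T" "c \<in> carrier R"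
        "v = t \<oplus>\<^bsub>M\<^esub> d \<odot>\<^bsub>M\<^esub> y" "t \<in> T" "d \<in> carrier R" using uU vU by blast
      have "u \<oplus>\<^bsub>M\<^esub> v = (s \<oplus>\<^bsub>M\<^esub> t) \<oplus>\<^bsub>M\<^esub> (c \<oplus> d) \<odot>\<^bsub>M\<^esub> y"
        using uv y Tc by (simp add: smult_l_distr M.a_ac)
      then show ?thesis using uv E by blast
    qed
  qed
qed

text \<open>
  A submodule \<open>T \<supseteq> S\<close> that is maximal among those avoiding \<open>x\<close> is a complement of the line through
  \<open>x\<close>: adding any further vector to \<open>T\<close> captures \<open>x\<close>, which can then be solved for that vector.  The
  functional is the coordinate along \<open>x\<close> modulo \<open>T\<close>.
\<close>

lemma separating_functional:
  assumes "field K" and "module K M" and S: "submodule S K M"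
    and x: "x \<in> carrier M" "x \<notin> S"
  shows "\<exists>\<phi>\<in>linear_functionals K M. (\<forall>s\<in>S. \<phi> s = \<zero>\<^bsub>K\<^esub>) \<and> \<phi> x \<noteq> \<zero>\<^bsub>K\<^esub>"
proof -
  interpret K: field K by fact
  interpret M: module K M by fact
  let ?A = "{T. submodule T K M \<and> S \<subseteq> T \<and> x \<notin> T}"
  have "\<exists>T\<in>?A. \<forall>U\<in>?A. T \<subseteq> U \<longrightarrow> U = T"
  proof (rule subset_Zorn_nonempty)
    show "?A \<noteq> {}" using S x by blast
    fix C assume ne: "C \<noteq> {}" and chain: "subset.chain ?A C"
    have CA: "C \<subseteq> ?A" and tot: "U \<subseteq> V \<or> V \<subseteq> U" if "U \<in> C" "V \<in> C" for U V
      using chain that unfolding subset_chain_def by blast+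
    have mem: "submodule U K M" "S \<subseteq> U" "x \<notin> U" if "U \<in> C" for U
      using CA[OF that that] that by blast+
    have "submodule (\<Union>C) K M" by (rule M.Union_chain_submodule[OF ne mem(1) tot])
    moreover have "S \<subseteq> \<Union>C" using ne mem(2) by blast
    moreover have "x \<notin> \<Union>C" using mem(3) by blast
    ultimately show "\<Union>C \<in> ?A" by simp
  qed
  then obtain T where "T \<in> ?A" and maxA: "\<forall>U\<in>?A. T \<subseteq> U \<longrightarrow> U = T" by (rule bexE)
  then have T: "submodule T K M" and ST: "S \<subseteq> T" and xT: "x \<notin> T" by simp_all
  have max: "U = T" if "submodule U K M" "T \<subseteq> U" "x \<notin> U" for U
    using bspec[OF maxA, of U] ST that by simp
  note Tc = M.submoduleE(1)[OF T, THEN subsetD] and E = M.submoduleE(3-5)[OF T]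
    and Tm = M.submodule_minus[OF T] and T0 = M.submodule_zero[OF T]
  have div: "z \<in> T" if "c \<in> carrier K" "c \<noteq> \<zero>\<^bsub>K\<^esub>" "z \<in> carrier M" "c \<odot>\<^bsub>M\<^esub> z \<in> T" for c z
  proof -
    have c: "inv\<^bsub>K\<^esub> c \<in> carrier K" "inv\<^bsub>K\<^esub> c \<otimes>\<^bsub>K\<^esub> c = \<one>\<^bsub>K\<^esub>"
      using that K.field_Units by auto
    have "inv\<^bsub>K\<^esub> c \<odot>\<^bsub>M\<^esub> (c \<odot>\<^bsub>M\<^esub> z) = z"
      using c that by (simp flip: M.smult_assoc1)
    then show ?thesis using E(2)[OF c(1) that(4)] by simp
  qed
  \<comment> \<open>Every vector is congruent to a unique multiple of \<open>x\<close> modulo \<open>T\<close>.\<close>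
  have ex: "\<exists>c\<in>carrier K. y \<ominus>\<^bsub>M\<^esub> c \<odot>\<^bsub>M\<^esub> x \<in> T" if y: "y \<in> carrier M" for y
  proof (cases "y \<in> T")
    case True
    then show ?thesis using y x by (intro bexI[of _ "\<zero>\<^bsub>K\<^esub>"]) (simp_all add: a_minus_def M.minus_zero_eq)
  next
    case False
    let ?U = "{t \<oplus>\<^bsub>M\<^esub> c \<odot>\<^bsub>M\<^esub> y | t c. t \<in> T \<and> c \<in> carrier K}"
    have "t \<in> ?U" if "t \<in> T" for t
    proof -
      have "t = t \<oplus>\<^bsub>M\<^esub> \<zero>\<^bsub>K\<^esub> \<odot>\<^bsub>M\<^esub> y" using Tc[OF that] y by simp
      then show ?thesis using that by blast
    qed
    moreover have "y \<in> ?U"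
    proof -
      have "y = \<zero>\<^bsub>M\<^esub> \<oplus>\<^bsub>M\<^esub> \<one>\<^bsub>K\<^esub> \<odot>\<^bsub>M\<^esub> y" using y by simp
      then show ?thesis using T0 by blast
    qed
    ultimately have "x \<in> ?U"
      using max[OF M.submodule_add_line[OF T y]] False by blast
    then obtain t c where tc: "x = t \<oplus>\<^bsub>M\<^esub> c \<odot>\<^bsub>M\<^esub> y" "t \<in> T" "c \<in> carrier K" by blast
    have "c \<noteq> \<zero>\<^bsub>K\<^esub>" using tc xT y Tc by auto
    then have c: "inv\<^bsub>K\<^esub> c \<in> carrier K" "c \<otimes>\<^bsub>K\<^esub> inv\<^bsub>K\<^esub> c = \<one>\<^bsub>K\<^esub>"
      using tc K.field_Units by auto
    have "c \<odot>\<^bsub>M\<^esub> (y \<ominus>\<^bsub>M\<^esub> inv\<^bsub>K\<^esub> c \<odot>\<^bsub>M\<^esub> x) = c \<odot>\<^bsub>M\<^esub> y \<ominus>\<^bsub>M\<^esub> x"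
      using c tc(3) x y
      by (simp add: a_minus_def M.smult_r_distr M.smult_r_minus flip: M.smult_assoc1)
    also have "\<dots> = \<ominus>\<^bsub>M\<^esub> t"
      unfolding tc(1) using tc(2,3) y Tc
      by (simp add: a_minus_def M.minus_add M.a_ac M.r_neg M.r_neg1 M.r_neg2)
    finally have "y \<ominus>\<^bsub>M\<^esub> inv\<^bsub>K\<^esub> c \<odot>\<^bsub>M\<^esub> x \<in> T"
      using div[of c] \<open>c \<noteq> \<zero>\<^bsub>K\<^esub>\<close> tc E(1) c(1) x y by simp
    then show ?thesis using c(1) by blast
  qed
  have uniq: "c = d" if cd: "c \<in> carrier K" "d \<in> carrier K" and y: "y \<in> carrier M"
    and c: "y \<ominus>\<^bsub>M\<^esub> c \<odot>\<^bsub>M\<^esub> x \<in> T" and d: "y \<ominus>\<^bsub>M\<^esub> d \<odot>\<^bsub>M\<^esub> x \<in> T" for c d y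
  proof (rule ccontr)
    assume "c \<noteq> d"
    have "(y \<ominus>\<^bsub>M\<^esub> c \<odot>\<^bsub>M\<^esub> x) \<ominus>\<^bsub>M\<^esub> (y \<ominus>\<^bsub>M\<^esub> d \<odot>\<^bsub>M\<^esub> x) = (d \<ominus>\<^bsub>K\<^esub> c) \<odot>\<^bsub>M\<^esub> x"
      using cd y x
      by (simp add: a_minus_def M.smult_l_distr M.smult_l_minus M.minus_add M.a_ac M.r_neg M.r_neg1 M.r_neg2)
    then have "(d \<ominus>\<^bsub>K\<^esub> c) \<odot>\<^bsub>M\<^esub> x \<in> T" using Tm[OF c d] by simp
    then show False using div[of "d \<ominus>\<^bsub>K\<^esub> c" x] cd \<open>c \<noteq> d\<close> x xT K.minus_eq_zero_iff by auto
  qed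
  define \<phi> where "\<phi> y = (THE c. c \<in> carrier K \<and> y \<ominus>\<^bsub>M\<^esub> c \<odot>\<^bsub>M\<^esub> x \<in> T)" for y
  have phiI: "\<phi> y = c" if "y \<in> carrier M" "c \<in> carrier K" "y \<ominus>\<^bsub>M\<^esub> c \<odot>\<^bsub>M\<^esub> x \<in> T" for y c
    unfolding \<phi>_def using that uniq by blast
  have phi: "\<phi> y \<in> carrier K" "y \<ominus>\<^bsub>M\<^esub> \<phi> y \<odot>\<^bsub>M\<^esub> x \<in> T" if "y \<in> carrier M" for y
    using ex[OF that] phiI[OF that] by auto
  have "\<phi> (y \<oplus>\<^bsub>M\<^esub> z) = \<phi> y \<oplus>\<^bsub>K\<^esub> \<phi> z" if yz: "y \<in> carrier M" "z \<in> carrier M" for y z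
  proof (rule phiI)
    have "(y \<oplus>\<^bsub>M\<^esub> z) \<ominus>\<^bsub>M\<^esub> (\<phi> y \<oplus>\<^bsub>K\<^esub> \<phi> z) \<odot>\<^bsub>M\<^esub> x =
        (y \<ominus>\<^bsub>M\<^esub> \<phi> y \<odot>\<^bsub>M\<^esub> x) \<oplus>\<^bsub>M\<^esub> (z \<ominus>\<^bsub>M\<^esub> \<phi> z \<odot>\<^bsub>M\<^esub> x)"
      using yz phi(1) x by (simp add: a_minus_def M.smult_l_distr M.minus_add M.a_ac)
    then show "(y \<oplus>\<^bsub>M\<^esub> z) \<ominus>\<^bsub>M\<^esub> (\<phi> y \<oplus>\<^bsub>K\<^esub> \<phi> z) \<odot>\<^bsub>M\<^esub> x \<in> T"
      using E(3) phi(2) yz by simp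
  qed (use yz phi(1) in auto)
  moreover have "\<phi> (c \<odot>\<^bsub>M\<^esub> y) = c \<otimes>\<^bsub>K\<^esub> \<phi> y" if cy: "c \<in> carrier K" "y \<in> carrier M" for c y
  proof (rule phiI)
    have "c \<odot>\<^bsub>M\<^esub> y \<ominus>\<^bsub>M\<^esub> (c \<otimes>\<^bsub>K\<^esub> \<phi> y) \<odot>\<^bsub>M\<^esub> x = c \<odot>\<^bsub>M\<^esub> (y \<ominus>\<^bsub>M\<^esub> \<phi> y \<odot>\<^bsub>M\<^esub> x)"
      using cy phi(1) x by (simp add: a_minus_def M.smult_r_distr M.smult_r_minus M.smult_assoc1)
    then show "c \<odot>\<^bsub>M\<^esub> y \<ominus>\<^bsub>M\<^esub> (c \<otimes>\<^bsub>K\<^esub> \<phi> y) \<odot>\<^bsub>M\<^esub> x \<in> T"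
      using E(2) phi(2) cy by simp
  qed (use cy phi(1) in auto)
  moreover have "\<phi> s = \<zero>\<^bsub>K\<^esub>" if "s \<in> S" for s
    using that ST Tc x by (intro phiI) (auto simp: a_minus_def M.minus_zero_eq)
  moreover have "\<phi> x = \<one>\<^bsub>K\<^esub>"
    using x T0 by (intro phiI) (simp_all add: a_minus_def M.r_neg)
  ultimately show ?thesis
    using phi(1) by (intro bexI[of _ \<phi>]) (auto simp: linear_functionals_def)
qed

section \<open>Homomorphisms and subalgebras\<close>

lemma
  assumes "f \<in> hom_algebra_hom K L M"
  shows hom_algebra_hom_closed: "x \<in> carrier L \<Longrightarrow> f x \<in> carrier M"
    and hom_algebra_hom_add: "x \<in> carrier L \<Longrightarrow> y \<in> carrier L \<Longrightarrow> f (x \<oplus>\<^bsub>L\<^esub> y) = f x \<oplus>\<^bsub>M\<^esub> f y"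
    and hom_algebra_hom_smult:
      "c \<in> carrier K \<Longrightarrow> x \<in> carrier L \<Longrightarrow> f (c \<odot>\<^bsub>L\<^esub> x) = c \<odot>\<^bsub>M\<^esub> f x"
    and hom_algebra_hom_bracket:
      "x \<in> carrier L \<Longrightarrow> y \<in> carrier L \<Longrightarrow> f (x \<otimes>\<^bsub>L\<^esub> y) = f x \<otimes>\<^bsub>M\<^esub> f y"
    and hom_algebra_hom_twist: "x \<in> carrier L \<Longrightarrow> f (twist L x) = twist M (f x)"
  using assms unfolding hom_algebra_hom_def by auto

lemmas hom_algebra_hom_simps = hom_algebra_hom_closed hom_algebra_hom_add hom_algebra_hom_smult
  hom_algebra_hom_bracket hom_algebra_hom_twist

lemma hom_algebra_hom_zero:
  assumes "hom_leibniz_algebra K L" "hom_leibniz_algebra K M" and f: "f \<in> hom_algebra_hom K L M"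
  shows "f \<zero>\<^bsub>L\<^esub> = \<zero>\<^bsub>M\<^esub>"
proof -
  interpret L: hom_leibniz_algebra K L by fact
  interpret M: hom_leibniz_algebra K M by fact
  show ?thesis
    using hom_algebra_hom_smult[OF f, of "\<zero>\<^bsub>K\<^esub>" "\<zero>\<^bsub>L\<^esub>"] hom_algebra_hom_closed[OF f, of "\<zero>\<^bsub>L\<^esub>"]
    by simp
qed

lemma hom_algebra_hom_minus:
  assumes "hom_leibniz_algebra K L" "hom_leibniz_algebra K M" and f: "f \<in> hom_algebra_hom K L M"
    and xy: "x \<in> carrier L" "y \<in> carrier L"
  shows "f (x \<ominus>\<^bsub>L\<^esub> y) = f x \<ominus>\<^bsub>M\<^esub> f y"
proof -
  interpret L: hom_leibniz_algebra K L by fact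
  interpret M: hom_leibniz_algebra K M by fact
  show ?thesis
    using xy hom_algebra_hom_simps[OF f]
    by (simp add: L.minus_eq_add_smult M.minus_eq_add_smult)
qed

lemma hom_algebra_hom_eq_iff:
  assumes "hom_leibniz_algebra K L" "hom_leibniz_algebra K M" and f: "f \<in> hom_algebra_hom K L M"
    and xy: "x \<in> carrier L" "y \<in> carrier L"
  shows "f x = f y \<longleftrightarrow> f (x \<ominus>\<^bsub>L\<^esub> y) = \<zero>\<^bsub>M\<^esub>"
proof -
  interpret M: hom_leibniz_algebra K M by fact
  have fxy: "f x \<in> carrier M" "f y \<in> carrier M" using xy hom_algebra_hom_closed[OF f] by auto
  show ?thesis
    unfolding hom_algebra_hom_minus[OF assms]
    using fxy by (rule M.minus_eq_zero_iff[symmetric])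
qed

text \<open>
  Capability is witnessed by epimorphisms whose kernel is the \<open>\<alpha>\<close>-center; this form avoids
  computing with cosets.
\<close>

lemma capable_of_epimorphism:
  assumes g: "hom_leibniz_algebra K g" and k: "hom_leibniz_algebra K k"
    and f: "f \<in> hom_algebra_hom K k g" "f ` carrier k = carrier g"
    and ker: "\<And>x. x \<in> carrier k \<Longrightarrow> f x = \<zero>\<^bsub>g\<^esub> \<longleftrightarrow> x \<in> alpha_center k"
  shows "capable K g"
proof -
  interpret k: hom_leibniz_algebra K k by (fact k)
  have "f x = f y \<longleftrightarrow> x \<ominus>\<^bsub>k\<^esub> y \<in> alpha_center k" if "x \<in> carrier k" "y \<in> carrier k" for x y
    using hom_algebra_hom_eq_iff[OF k g f(1) that] ker[of "x \<ominus>\<^bsub>k\<^esub> y"] that by simp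
  then show ?thesis using capableI[OF g k] isomorphic_quotient_iff[OF g k] f by blast
qed

lemma hom_leibniz_subalgebra:
  assumes "hom_leibniz_algebra K L" and H: "submodule H K L"
    and bracket: "\<And>x y. x \<in> H \<Longrightarrow> y \<in> H \<Longrightarrow> x \<otimes>\<^bsub>L\<^esub> y \<in> H"
    and twist: "\<And>x. x \<in> H \<Longrightarrow> twist L x \<in> H"
  shows "hom_leibniz_algebra K (L\<lparr>carrier := H\<rparr>)"
proof -
  interpret L: hom_leibniz_algebra K L by fact
  interpret H: module K "L\<lparr>carrier := H\<rparr>"
    by (rule submodule.submodule_is_module[OF H L.module_axioms])
  note Hc = L.submoduleE(1)[OF H, THEN subsetD]
  have minus: "x \<ominus>\<^bsub>L\<lparr>carrier := H\<rparr>\<^esub> y = x \<ominus>\<^bsub>L\<^esub> y" if "x \<in> H" "y \<in> H" for x y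
    using that H.minus_eq_add_smult[of x y] L.minus_eq_add_smult[of x y] Hc by simp
  show ?thesis
    by (intro hom_leibniz_algebra.intro hom_leibniz_algebra_axioms.intro
        hom_leibniz_algebra.axioms(1)[OF assms(1)] H.module_axioms)
      (auto simp: bracket twist minus Hc L.bracket_add_left L.bracket_add_right
        L.bracket_smult_left L.bracket_smult_right L.twist_add L.twist_smult L.twist_bracket
        L.hom_leibniz_identity)
qed

lemma hom_leibniz_kernel:
  assumes L: "hom_leibniz_algebra K L" and M: "hom_leibniz_algebra K M"
    and f: "f \<in> hom_algebra_hom K L M"
  shows "hom_leibniz_algebra K (L\<lparr>carrier := {x \<in> carrier L. f x = \<zero>\<^bsub>M\<^esub>}\<rparr>)"
proof -
  interpret L: hom_leibniz_algebra K L by fact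
  interpret M: hom_leibniz_algebra K M by fact
  note simps = hom_algebra_hom_simps[OF f] hom_algebra_hom_zero[OF L M f]
  have twist0: "twist M \<zero>\<^bsub>M\<^esub> = \<zero>\<^bsub>M\<^esub>"
    using M.twist_smult[of "\<zero>\<^bsub>K\<^esub>" "\<zero>\<^bsub>M\<^esub>"] M.twist_closed by simp
  have "\<ominus>\<^bsub>L\<^esub> x = (\<ominus>\<^bsub>K\<^esub> \<one>\<^bsub>K\<^esub>) \<odot>\<^bsub>L\<^esub> x" if "x \<in> carrier L" for x
    using that by (simp add: L.smult_l_minus)
  then have "submodule {x \<in> carrier L. f x = \<zero>\<^bsub>M\<^esub>} K L"
    by (intro L.submoduleI) (auto simp: simps)
  then show ?thesis
    by (rule hom_leibniz_subalgebra[OF L])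
      (auto simp: simps twist0 L.bracket_closed L.twist_closed M.bracket_zero)
qed

section \<open>Extension by squares of characters\<close>

text \<open>
  These are the linear functionals on the quotient of \<open>L\<close> by the span of \<open>[L,L]\<close> and \<open>N\<close>, described
  on \<open>L\<close>.
\<close>

definition characters ::
    "('k, 'm) ring_scheme \<Rightarrow> ('k, 'v) hom_algebra \<Rightarrow> 'v set \<Rightarrow> ('v \<Rightarrow> 'k) set"
  where "characters K L N =
    {\<phi> \<in> linear_functionals K L.
      (\<forall>x\<in>carrier L. \<forall>y\<in>carrier L. \<phi> (x \<otimes>\<^bsub>L\<^esub> y) = \<zero>\<^bsub>K\<^esub>) \<and> (\<forall>z\<in>N. \<phi> z = \<zero>\<^bsub>K\<^esub>)}"

text \<open>
  The central extension of \<open>L\<close> by the cocycle that sends \<open>(x, y)\<close> to the family of all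
  \<open>\<phi>(x) \<phi>(y)\<close>; this family is the image of \<open>x \<otimes> y\<close> under evaluation at the pure tensors
  \<open>\<phi> \<otimes> \<phi>\<close>.  The new component consists of functions on all maps \<open>\<phi>\<close>, so that no extensionality
  condition is needed; brackets and values of the self-map vanish at
  non-characters.
\<close>

definition square_extension ::
    "('k, 'm) ring_scheme \<Rightarrow> ('k, 'v) hom_algebra \<Rightarrow> 'v set \<Rightarrow>
      ('k, 'v \<times> (('v \<Rightarrow> 'k) \<Rightarrow> 'k)) hom_algebra"
  where "square_extension K L N =
    \<lparr>carrier = carrier L \<times> {m. \<forall>\<phi>. m \<phi> \<in> carrier K},
     mult = (\<lambda>(x, m) (y, n). (x \<otimes>\<^bsub>L\<^esub> y,
       \<lambda>\<phi>. if \<phi> \<in> characters K L N then \<phi> x \<otimes>\<^bsub>K\<^esub> \<phi> y else \<zero>\<^bsub>K\<^esub>)),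
     one = undefined,
     zero = (\<zero>\<^bsub>L\<^esub>, \<lambda>\<phi>. \<zero>\<^bsub>K\<^esub>),
     add = (\<lambda>(x, m) (y, n). (x \<oplus>\<^bsub>L\<^esub> y, \<lambda>\<phi>. m \<phi> \<oplus>\<^bsub>K\<^esub> n \<phi>)),
     smult = (\<lambda>c (x, m). (c \<odot>\<^bsub>L\<^esub> x, \<lambda>\<phi>. c \<otimes>\<^bsub>K\<^esub> m \<phi>)),
     twist = (\<lambda>(x, m). (twist L x,
       \<lambda>\<phi>. if \<phi> \<in> characters K L N then m (\<phi> \<circ> twist L) else \<zero>\<^bsub>K\<^esub>))\<rparr>"

lemma
  assumes "\<phi> \<in> characters K L N"
  shows character_closed: "x \<in> carrier L \<Longrightarrow> \<phi> x \<in> carrier K"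
    and character_add: "x \<in> carrier L \<Longrightarrow> y \<in> carrier L \<Longrightarrow> \<phi> (x \<oplus>\<^bsub>L\<^esub> y) = \<phi> x \<oplus>\<^bsub>K\<^esub> \<phi> y"
    and character_smult: "c \<in> carrier K \<Longrightarrow> x \<in> carrier L \<Longrightarrow> \<phi> (c \<odot>\<^bsub>L\<^esub> x) = c \<otimes>\<^bsub>K\<^esub> \<phi> x"
    and character_bracket: "x \<in> carrier L \<Longrightarrow> y \<in> carrier L \<Longrightarrow> \<phi> (x \<otimes>\<^bsub>L\<^esub> y) = \<zero>\<^bsub>K\<^esub>"
    and character_null: "z \<in> N \<Longrightarrow> \<phi> z = \<zero>\<^bsub>K\<^esub>"
  using assms unfolding characters_def linear_functionals_def by auto

lemmas character_simps = character_closed character_add character_smult character_bracket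
  character_null

lemma character_comp_twist:
  assumes "hom_leibniz_algebra K L" and "\<And>z. z \<in> N \<Longrightarrow> twist L z \<in> N"
    and \<phi>: "\<phi> \<in> characters K L N"
  shows "\<phi> \<circ> twist L \<in> characters K L N"
proof -
  interpret L: hom_leibniz_algebra K L by fact
  show ?thesis
    unfolding characters_def linear_functionals_def
    by (auto simp: character_simps[OF \<phi>] assms(2) L.twist_closed L.twist_add L.twist_smult
        L.twist_bracket)
qed

lemma square_extension_simps:
  "carrier (square_extension K L N) = carrier L \<times> {m. \<forall>\<phi>. m \<phi> \<in> carrier K}"
  "(x, m) \<otimes>\<^bsub>square_extension K L N\<^esub> (y, n) =
    (x \<otimes>\<^bsub>L\<^esub> y, \<lambda>\<phi>. if \<phi> \<in> characters K L N then \<phi> x \<otimes>\<^bsub>K\<^esub> \<phi> y else \<zero>\<^bsub>K\<^esub>)"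
  "\<zero>\<^bsub>square_extension K L N\<^esub> = (\<zero>\<^bsub>L\<^esub>, \<lambda>\<phi>. \<zero>\<^bsub>K\<^esub>)"
  "(x, m) \<oplus>\<^bsub>square_extension K L N\<^esub> (y, n) = (x \<oplus>\<^bsub>L\<^esub> y, \<lambda>\<phi>. m \<phi> \<oplus>\<^bsub>K\<^esub> n \<phi>)"
  "c \<odot>\<^bsub>square_extension K L N\<^esub> (x, m) = (c \<odot>\<^bsub>L\<^esub> x, \<lambda>\<phi>. c \<otimes>\<^bsub>K\<^esub> m \<phi>)"
  "twist (square_extension K L N) (x, m) =
    (twist L x, \<lambda>\<phi>. if \<phi> \<in> characters K L N then m (\<phi> \<circ> twist L) else \<zero>\<^bsub>K\<^esub>)"
  by (simp_all add: square_extension_def)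

text \<open>
  Characters vanish on brackets, so each term of the Hom-Leibniz identity has zero new component.
  Invariance of \<open>N\<close> makes the characters closed under precomposition with the twist, and this is
  what multiplicativity of the extended twist amounts to.
\<close>

lemma hom_leibniz_square_extension:
  assumes L: "hom_leibniz_algebra K L" and N: "\<And>z. z \<in> N \<Longrightarrow> twist L z \<in> N"
  shows "hom_leibniz_algebra K (square_extension K L N)"
proof -
  interpret L: hom_leibniz_algebra K L by fact
  let ?E = "square_extension K L N"
  note S = square_extension_simps
  have "abelian_group ?E"
  proof (rule abelian_groupI)
    show "\<exists>y\<in>carrier ?E. y \<oplus>\<^bsub>?E\<^esub> x = \<zero>\<^bsub>?E\<^esub>" if "x \<in> carrier ?E" for x
      using that
      by (intro bexI[of _ "(\<ominus>\<^bsub>L\<^esub> fst x, \<lambda>\<phi>. \<ominus>\<^bsub>K\<^esub> snd x \<phi>)"]) (auto simp: S L.l_neg L.K.l_neg)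
  qed (auto simp: S L.a_ac L.K.a_ac)
  then have "module K ?E"
    by (auto intro!: moduleI L.K.is_cring simp: S L.smult_l_distr L.smult_r_distr L.smult_assoc1
        L.K.l_distr L.K.r_distr L.K.m_assoc)
  then interpret E: module K ?E .
  have minus: "(x, m) \<ominus>\<^bsub>?E\<^esub> (y, n) = (x \<ominus>\<^bsub>L\<^esub> y, \<lambda>\<phi>. m \<phi> \<ominus>\<^bsub>K\<^esub> n \<phi>)"
    if "(x, m) \<in> carrier ?E" "(y, n) \<in> carrier ?E" for x m y n
    using that
    by (simp add: E.minus_eq_add_smult L.minus_eq_add_smult S L.K.l_minus L.K.minus_eq)
  \<comment> \<open>Extending every character by zero over the other indices makes the bracket uniform in \<open>\<phi>\<close>.\<close>
  define \<chi> where "\<chi> \<phi> x = (if \<phi> \<in> characters K L N then \<phi> x else \<zero>\<^bsub>K\<^esub>)" for \<phi> x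
  have \<chi>: "\<chi> \<phi> x \<in> carrier K" "\<chi> \<phi> (x \<oplus>\<^bsub>L\<^esub> y) = \<chi> \<phi> x \<oplus>\<^bsub>K\<^esub> \<chi> \<phi> y"
    "c \<in> carrier K \<Longrightarrow> \<chi> \<phi> (c \<odot>\<^bsub>L\<^esub> x) = c \<otimes>\<^bsub>K\<^esub> \<chi> \<phi> x" "\<chi> \<phi> (x \<otimes>\<^bsub>L\<^esub> y) = \<zero>\<^bsub>K\<^esub>"
    if "x \<in> carrier L" "y \<in> carrier L" for \<phi> x y c
    using that character_simps(1-4)[of \<phi> K L N] by (auto simp: \<chi>_def)
  have \<chi>_twist: "\<chi> (\<phi> \<circ> twist L) x = \<chi> \<phi> (twist L x)" if "\<phi> \<in> characters K L N" for \<phi> x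
    using that character_comp_twist[OF L N] by (simp add: \<chi>_def)
  have \<chi>_zero: "\<chi> \<phi> x = \<zero>\<^bsub>K\<^esub>" if "\<phi> \<notin> characters K L N" for \<phi> x
    using that by (simp add: \<chi>_def)
  have mult: "(x, m) \<otimes>\<^bsub>?E\<^esub> (y, n) = (x \<otimes>\<^bsub>L\<^esub> y, \<lambda>\<phi>. \<chi> \<phi> x \<otimes>\<^bsub>K\<^esub> \<chi> \<phi> y)" for x y m n
    by (auto simp: S \<chi>_def intro!: ext)
  show ?thesis
    by (intro hom_leibniz_algebra.intro hom_leibniz_algebra_axioms.intro
        hom_leibniz_algebra.axioms(1)[OF L] E.module_axioms)
      (auto simp: S(1,3-) mult minus \<chi> \<chi>_twist \<chi>_zero L.bracket_closed L.twist_closed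
        L.bracket_add_left L.bracket_add_right L.bracket_smult_left L.bracket_smult_right
        L.twist_add L.twist_smult L.twist_bracket L.hom_leibniz_identity
        L.K.l_distr L.K.r_distr L.K.m_ac L.K.minus_eq intro!: ext)
qed

lemma twist_pow_square_extension:
  "\<exists>n. (twist (square_extension K L N) ^^ i) (x, m) = ((twist L ^^ i) x, n)"
  by (induction i) (auto simp: square_extension_simps)

text \<open>
  If \<open>(x, m)\<close> is \<open>\<alpha>\<close>-central, then bracketing an iterated twist \<open>u\<close> of \<open>x\<close> with itself gives
  \<open>\<phi>(u) \<phi>(u) = 0\<close>, hence \<open>\<phi>(u) = 0\<close> in the field.
\<close>

lemma alpha_center_square_extension:
  assumes L: "hom_leibniz_algebra K L" and N: "\<And>z. z \<in> N \<Longrightarrow> twist L z \<in> N"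
    and m: "\<And>\<phi>. m \<phi> \<in> carrier K"
  shows "(x, m) \<in> alpha_center (square_extension K L N) \<longleftrightarrow>
    x \<in> alpha_center L \<and> (\<forall>i. \<forall>\<phi>\<in>characters K L N. \<phi> ((twist L ^^ i) x) = \<zero>\<^bsub>K\<^esub>)"
    (is "?l \<longleftrightarrow> ?r")
proof
  interpret L: hom_leibniz_algebra K L by fact
  let ?E = "square_extension K L N"
  {
    assume l: ?l
    then have x: "x \<in> carrier L" by (auto simp: alpha_center_def square_extension_simps)
    have *: "(twist L ^^ i) x \<otimes>\<^bsub>L\<^esub> y = \<zero>\<^bsub>L\<^esub> \<and> y \<otimes>\<^bsub>L\<^esub> (twist L ^^ i) x = \<zero>\<^bsub>L\<^esub> \<and>
      (\<forall>\<phi>\<in>characters K L N. \<phi> ((twist L ^^ i) x) \<otimes>\<^bsub>K\<^esub> \<phi> y = \<zero>\<^bsub>K\<^esub>)"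
      if y: "y \<in> carrier L" for y i
    proof -
      obtain n where n: "(twist ?E ^^ i) (x, m) = ((twist L ^^ i) x, n)"
        using twist_pow_square_extension[of i K L N x m] by blast
      have "(y, \<lambda>_. \<zero>\<^bsub>K\<^esub>) \<in> carrier ?E" using y by (simp add: square_extension_simps)
      then have "(twist ?E ^^ i) (x, m) \<otimes>\<^bsub>?E\<^esub> (y, \<lambda>_. \<zero>\<^bsub>K\<^esub>) = \<zero>\<^bsub>?E\<^esub>"
        "(y, \<lambda>_. \<zero>\<^bsub>K\<^esub>) \<otimes>\<^bsub>?E\<^esub> (twist ?E ^^ i) (x, m) = \<zero>\<^bsub>?E\<^esub>"
        using l unfolding alpha_center_def by blast+
      then show ?thesis
        unfolding n square_extension_simps by (auto dest: fun_cong split: if_splits)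
    qed
    have "\<phi> ((twist L ^^ i) x) = \<zero>\<^bsub>K\<^esub>" if "\<phi> \<in> characters K L N" for \<phi> i
      using *[OF L.twist_pow(1)[OF x], of i i] that character_closed[OF that L.twist_pow(1)[OF x]]
        L.K.integral by blast
    then show ?r using * x by (simp add: alpha_center_def)
  }
  {
    assume r: ?r
    then have x: "x \<in> carrier L" by (simp add: alpha_center_def)
    have "(twist ?E ^^ i) (x, m) \<otimes>\<^bsub>?E\<^esub> y = \<zero>\<^bsub>?E\<^esub> \<and> y \<otimes>\<^bsub>?E\<^esub> (twist ?E ^^ i) (x, m) = \<zero>\<^bsub>?E\<^esub>"
      if y: "y \<in> carrier ?E" for y i
    proof -
      obtain n where n: "(twist ?E ^^ i) (x, m) = ((twist L ^^ i) x, n)"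
        using twist_pow_square_extension[of i K L N x m] by blast
      obtain u l where u: "y = (u, l)" "u \<in> carrier L"
        using y by (auto simp: square_extension_simps)
      have "\<phi> ((twist L ^^ i) x) \<otimes>\<^bsub>K\<^esub> \<phi> u = \<zero>\<^bsub>K\<^esub>" "\<phi> u \<otimes>\<^bsub>K\<^esub> \<phi> ((twist L ^^ i) x) = \<zero>\<^bsub>K\<^esub>"
        if "\<phi> \<in> characters K L N" for \<phi>
      proof -
        have "\<phi> ((twist L ^^ i) x) = \<zero>\<^bsub>K\<^esub>" using r that by blast
        then show "\<phi> ((twist L ^^ i) x) \<otimes>\<^bsub>K\<^esub> \<phi> u = \<zero>\<^bsub>K\<^esub>"
          "\<phi> u \<otimes>\<^bsub>K\<^esub> \<phi> ((twist L ^^ i) x) = \<zero>\<^bsub>K\<^esub>"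
          using character_closed[OF that u(2)] by simp_all
      qed
      then show ?thesis
        unfolding n u(1) using u(2) r
        by (auto simp: square_extension_simps L.alpha_centerD intro!: ext)
    qed
    then show ?l using x m by (auto simp: alpha_center_def square_extension_simps)
  }
qed

section \<open>Capability of the summands\<close>

text \<open>
  The epimorphism from \<open>k\<close> onto \<open>g1 \<oplus> g2\<close> enters through its two components \<open>p\<close> and \<open>q\<close>, so
  that the lemma serves both summands.
\<close>

lemma capable_first_factor:
  assumes k: "hom_leibniz_algebra K k"
    and g1: "hom_leibniz_algebra K g1" and g2: "hom_leibniz_algebra K g2"
    and p: "p \<in> hom_algebra_hom K k g1" and q: "q \<in> hom_algebra_hom K k g2"
    and onto: "\<And>a b. a \<in> carrier g1 \<Longrightarrow> b \<in> carrier g2 \<Longrightarrow> \<exists>x\<in>carrier k. p x = a \<and> q x = b"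
    and ker: "\<And>x. x \<in> carrier k \<Longrightarrow>
      p x = \<zero>\<^bsub>g1\<^esub> \<and> q x = \<zero>\<^bsub>g2\<^esub> \<longleftrightarrow> x \<in> alpha_center k"
    and surj: "twist g2 ` carrier g2 = carrier g2"
  shows "capable K g1"
proof -
  interpret k: hom_leibniz_algebra K k by (fact k)
  interpret g1: hom_leibniz_algebra K g1 by (fact g1)
  interpret g2: hom_leibniz_algebra K g2 by (fact g2)
  note p_simps = hom_algebra_hom_simps[OF p] hom_algebra_hom_minus[OF k g1 p]
  note q_simps = hom_algebra_hom_simps[OF q] hom_algebra_hom_minus[OF k g2 q]
  define Z where "Z = alpha_center k"
  define k1 where "k1 = {x \<in> carrier k. q x = \<zero>\<^bsub>g2\<^esub>}"
  define k2 where "k2 = {y \<in> carrier k. p y = \<zero>\<^bsub>g1\<^esub>}"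
  define h where "h = k\<lparr>carrier := k1\<rparr>"
  have h_simps: "carrier h = k1" "mult h = mult k" "add h = add k" "zero h = zero k"
    "smult h = smult k" "twist h = twist k"
    by (simp_all add: h_def)
  have h: "hom_leibniz_algebra K h"
    unfolding h_def k1_def by (rule hom_leibniz_kernel[OF k g2 q])
  interpret h: hom_leibniz_algebra K h by (fact h)
  have k1c: "x \<in> carrier k" if "x \<in> k1" for x using that by (simp add: k1_def)
  have k2c: "y \<in> carrier k" if "y \<in> k2" for y using that by (simp add: k2_def)
  have Z_iff: "Z = k1 \<inter> k2" using ker by (auto simp: Z_def k1_def k2_def alpha_center_def)
  have Zc: "z \<in> carrier k" if "z \<in> Z" for z using that by (simp add: Z_def alpha_center_def)
  have Z_null: "z \<otimes>\<^bsub>k\<^esub> x = \<zero>\<^bsub>k\<^esub>" "x \<otimes>\<^bsub>k\<^esub> z = \<zero>\<^bsub>k\<^esub>" if "z \<in> Z" "x \<in> carrier k" for z x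
    using k.alpha_center_ideal(2,3) that by (auto simp: Z_def)
  have Z_twist: "twist k z \<in> Z" if "z \<in> Z" for z
    using k.alpha_center_ideal(1)[of z z] that Zc by (simp add: Z_def)
  have k12: "x \<otimes>\<^bsub>k\<^esub> y \<in> Z" "y \<otimes>\<^bsub>k\<^esub> x \<in> Z" if "x \<in> k1" "y \<in> k2" for x y
    using that unfolding Z_iff
    by (auto simp: k1_def k2_def k.bracket_closed p_simps q_simps g1.bracket_zero g2.bracket_zero)
  have split: "\<exists>x\<in>k1. \<exists>y\<in>k2. u = x \<oplus>\<^bsub>k\<^esub> y" if u: "u \<in> carrier k" for u
  proof -
    obtain x where x: "x \<in> carrier k" "p x = p u" "q x = \<zero>\<^bsub>g2\<^esub>"
      using onto[of "p u" "\<zero>\<^bsub>g2\<^esub>"] p_simps(1)[OF u] by auto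
    have "u \<ominus>\<^bsub>k\<^esub> x \<in> k2"
      using x u p_simps(1)[OF u] by (simp add: k2_def p_simps g1.minus_eq_zero_iff)
    moreover have "u = x \<oplus>\<^bsub>k\<^esub> (u \<ominus>\<^bsub>k\<^esub> x)"
      using x u by (simp add: a_minus_def k.a_lcomm k.r_neg)
    ultimately show ?thesis using x by (auto simp: k1_def)
  qed
  \<comment> \<open>\<open>k2 = \<alpha>(k2) + Z\<close>, by surjectivity of the twist on \<open>g2\<close>.\<close>
  have lift: "\<exists>y'\<in>k2. \<exists>z\<in>Z. y = twist k y' \<oplus>\<^bsub>k\<^esub> z" if y: "y \<in> k2" for y
  proof -
    note yc = k2c[OF y]
    obtain b where b: "b \<in> carrier g2" "twist g2 b = q y"
      using surj q_simps(1)[OF yc] by (metis imageE)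
    obtain y' where y': "y' \<in> carrier k" "p y' = \<zero>\<^bsub>g1\<^esub>" "q y' = b"
      using onto[of "\<zero>\<^bsub>g1\<^esub>" b] b by auto
    have t0: "twist g1 \<zero>\<^bsub>g1\<^esub> = \<zero>\<^bsub>g1\<^esub>"
      using g1.twist_smult[of "\<zero>\<^bsub>K\<^esub>" "\<zero>\<^bsub>g1\<^esub>"] g1.twist_closed by simp
    have ty: "twist k y' \<in> carrier k" using y' k.twist_closed by simp
    have "y \<ominus>\<^bsub>k\<^esub> twist k y' \<in> Z"
      unfolding Z_iff using yc y y' b ty q_simps(1)[OF yc]
      by (simp add: k1_def k2_def p_simps q_simps t0 g1.minus_eq_zero_iff g2.minus_eq_zero_iff)
    moreover have "y = twist k y' \<oplus>\<^bsub>k\<^esub> (y \<ominus>\<^bsub>k\<^esub> twist k y')"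
      using yc ty by (simp add: a_minus_def k.a_lcomm k.r_neg)
    ultimately show ?thesis using y' by (auto simp: k2_def)
  qed
  \<comment> \<open>The part of \<open>k1\<close> that commutes with \<open>k2\<close>.  It contains all brackets of \<open>k1\<close> and all of \<open>Z\<close>,
    so a functional vanishing on it is a character.\<close>
  define C where "C = {x \<in> k1. \<forall>y\<in>k2. x \<otimes>\<^bsub>k\<^esub> y = \<zero>\<^bsub>k\<^esub> \<and> y \<otimes>\<^bsub>k\<^esub> x = \<zero>\<^bsub>k\<^esub>}"
  have bracket_C: "a \<otimes>\<^bsub>k\<^esub> b \<in> C" if ab: "a \<in> k1" "b \<in> k1" for a b
  proof -
    note c = k1c[OF ab(1)] k1c[OF ab(2)]
    have abk: "a \<otimes>\<^bsub>k\<^esub> b \<in> k1" using ab h.bracket_closed by (simp add: h_simps)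
    have "(a \<otimes>\<^bsub>k\<^esub> b) \<otimes>\<^bsub>k\<^esub> y = \<zero>\<^bsub>k\<^esub> \<and> y \<otimes>\<^bsub>k\<^esub> (a \<otimes>\<^bsub>k\<^esub> b) = \<zero>\<^bsub>k\<^esub>" if y: "y \<in> k2" for y
    proof -
      obtain y' z where y': "y' \<in> k2" "z \<in> Z" "y = twist k y' \<oplus>\<^bsub>k\<^esub> z" using lift[OF y] by blast
      note yc = k2c[OF y'(1)]
      note cl = c yc k.twist_closed k.bracket_closed Zc[OF y'(2)]
      \<comment> \<open>In both instances of the identity the other two terms contain a bracket of \<open>k1\<close> with \<open>k2\<close>,
        which lies in \<open>Z\<close>.\<close>
      have "twist k y' \<otimes>\<^bsub>k\<^esub> (a \<otimes>\<^bsub>k\<^esub> b) = \<zero>\<^bsub>k\<^esub>"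
        using k.hom_leibniz_identity[of y' a b] cl k12(2)[OF ab(1) y'(1)] k12(2)[OF ab(2) y'(1)]
        by (simp add: Z_null a_minus_def k.minus_zero_eq)
      moreover have "(a \<otimes>\<^bsub>k\<^esub> b) \<otimes>\<^bsub>k\<^esub> twist k y' = \<zero>\<^bsub>k\<^esub>"
        using k.hom_leibniz_identity[of a b y'] cl k12(1)[OF ab(1) y'(1)] k12(1)[OF ab(2) y'(1)]
        by (simp add: Z_null a_minus_def k.minus_zero_eq)
      ultimately show ?thesis
        using cl y'(2) by (simp add: y'(3) k.bracket_add_left k.bracket_add_right Z_null)
    qed
    then show ?thesis using abk by (simp add: C_def)
  qed
  have Z_C: "Z \<subseteq> C" using Z_null k2c Z_iff by (auto simp: C_def)
  have C_submodule: "submodule C K h"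
  proof (rule h.submoduleI)
    show "C \<subseteq> carrier h" by (auto simp: C_def h_simps)
    show "\<zero>\<^bsub>h\<^esub> \<in> C"
      using h.zero_closed k.bracket_zero k2c by (auto simp: C_def h_simps)
    show "a \<oplus>\<^bsub>h\<^esub> b \<in> C" if "a \<in> C" "b \<in> C" for a b
      using that h.a_closed[of a b] k1c k2c
      by (auto simp: C_def h_simps k.bracket_add_left k.bracket_add_right)
    show smult: "c \<odot>\<^bsub>h\<^esub> a \<in> C" if "c \<in> carrier K" "a \<in> C" for c a
      using that h.smult_closed[of c a] k1c k2c
      by (auto simp: C_def h_simps k.bracket_smult_left k.bracket_smult_right)
    show "\<ominus>\<^bsub>h\<^esub> a \<in> C" if "a \<in> C" for a
    proof -
      have "a \<in> carrier h" using that by (simp add: C_def h_simps)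
      then have "\<ominus>\<^bsub>h\<^esub> a = (\<ominus>\<^bsub>K\<^esub> \<one>\<^bsub>K\<^esub>) \<odot>\<^bsub>h\<^esub> a" by (simp add: h.smult_l_minus)
      then show ?thesis using smult[OF _ that] by simp
    qed
  qed
  have in_C: "x \<in> C" if x: "x \<in> k1" and \<phi>: "\<And>\<phi>. \<phi> \<in> characters K h Z \<Longrightarrow> \<phi> x = \<zero>\<^bsub>K\<^esub>" for x
  proof (rule ccontr)
    assume "x \<notin> C"
    moreover have "x \<in> carrier h" using x by (simp add: h_simps)
    ultimately obtain \<psi> where "\<psi> \<in> linear_functionals K h" "\<forall>s\<in>C. \<psi> s = \<zero>\<^bsub>K\<^esub>"
      and nz: "\<psi> x \<noteq> \<zero>\<^bsub>K\<^esub>"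
      using separating_functional[OF hom_leibniz_algebra.axioms(1)[OF h] h.module_axioms
          C_submodule] by blast
    then have "\<psi> \<in> characters K h Z"
      using bracket_C Z_C by (simp add: characters_def h_simps subset_iff)
    then show False using \<phi>[of \<psi>] nz by simp
  qed
  define E where "E = square_extension K h Z"
  have Z_twist_h: "twist h z \<in> Z" if "z \<in> Z" for z using Z_twist[OF that] by (simp add: h_simps)
  have E: "hom_leibniz_algebra K E"
    unfolding E_def by (rule hom_leibniz_square_extension[OF h Z_twist_h])
  have E_carrier: "carrier E = k1 \<times> {m. \<forall>\<phi>. m \<phi> \<in> carrier K}"
    by (simp add: E_def square_extension_simps h_simps)
  have center: "(x, m) \<in> alpha_center E \<longleftrightarrow> x \<in> Z" if x: "x \<in> k1" and m: "\<And>\<phi>. m \<phi> \<in> carrier K" for x m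
  proof -
    have pow: "(twist k ^^ i) x \<in> k1" for i
      using h.twist_pow(1)[of x i] x by (simp add: h_simps)
    have iff: "(x, m) \<in> alpha_center E \<longleftrightarrow> x \<in> alpha_center h \<and>
        (\<forall>i. \<forall>\<phi>\<in>characters K h Z. \<phi> ((twist k ^^ i) x) = \<zero>\<^bsub>K\<^esub>)"
      unfolding E_def using alpha_center_square_extension[OF h Z_twist_h m] by (simp add: h_simps)
    show ?thesis
    proof
      assume "x \<in> Z"
      then have pow_Z: "(twist k ^^ i) x \<in> Z" for i by (induction i) (auto simp: Z_twist)
      have "x \<in> alpha_center h" using x pow_Z Z_null k1c by (simp add: alpha_center_def h_simps)
      moreover have "\<phi> ((twist k ^^ i) x) = \<zero>\<^bsub>K\<^esub>" if "\<phi> \<in> characters K h Z" for \<phi> i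
        by (rule character_null[OF that pow_Z])
      ultimately show "(x, m) \<in> alpha_center E" unfolding iff by (intro conjI allI ballI)
    next
      assume l: "(x, m) \<in> alpha_center E"
      then have xh: "x \<in> alpha_center h" unfolding iff by blast
      have "(twist k ^^ i) x \<otimes>\<^bsub>k\<^esub> u = \<zero>\<^bsub>k\<^esub> \<and> u \<otimes>\<^bsub>k\<^esub> (twist k ^^ i) x = \<zero>\<^bsub>k\<^esub>"
        if u: "u \<in> carrier k" for u i
      proof -
        obtain a b where ab: "a \<in> k1" "b \<in> k2" "u = a \<oplus>\<^bsub>k\<^esub> b" using split[OF u] by blast
        \<comment> \<open>The characters control the bracket with \<open>k2\<close>, the \<open>\<alpha>\<close>-center of \<open>k1\<close> that with \<open>k1\<close>.\<close>
        have "(twist k ^^ i) x \<in> C" using l pow in_C unfolding iff by blast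
        then have b0: "(twist k ^^ i) x \<otimes>\<^bsub>k\<^esub> b = \<zero>\<^bsub>k\<^esub>" "b \<otimes>\<^bsub>k\<^esub> (twist k ^^ i) x = \<zero>\<^bsub>k\<^esub>"
          using ab(2) by (auto simp: C_def)
        have "(twist k ^^ i) x \<otimes>\<^bsub>k\<^esub> a = \<zero>\<^bsub>k\<^esub>" "a \<otimes>\<^bsub>k\<^esub> (twist k ^^ i) x = \<zero>\<^bsub>k\<^esub>"
          using h.alpha_centerD[OF xh, of a i] ab(1) by (auto simp: h_simps)
        then show ?thesis
          using b0 k1c[OF ab(1)] k2c[OF ab(2)] k1c[OF pow]
          by (simp add: ab(3) k.bracket_add_left k.bracket_add_right)
      qed
      then show "x \<in> Z" using k1c[OF x] by (simp add: Z_def alpha_center_def)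
    qed
  qed
  show ?thesis
  proof (rule capable_of_epimorphism[OF g1 E])
    show "p \<circ> fst \<in> hom_algebra_hom K E g1"
      unfolding hom_algebra_hom_def E_carrier
      by (auto simp: E_def square_extension_simps h_simps p_simps k1c)
    show "(p \<circ> fst) ` carrier E = carrier g1"
    proof
      show "(p \<circ> fst) ` carrier E \<subseteq> carrier g1" by (auto simp: E_carrier p_simps k1c)
      show "carrier g1 \<subseteq> (p \<circ> fst) ` carrier E"
      proof
        fix a assume "a \<in> carrier g1"
        then obtain x where "x \<in> k1" "p x = a" using onto[of a "\<zero>\<^bsub>g2\<^esub>"] by (auto simp: k1_def)
        then show "a \<in> (p \<circ> fst) ` carrier E"
          by (intro image_eqI[of _ _ "(x, \<lambda>_. \<zero>\<^bsub>K\<^esub>)"]) (auto simp: E_carrier)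
      qed
    qed
    show "(p \<circ> fst) e = \<zero>\<^bsub>g1\<^esub> \<longleftrightarrow> e \<in> alpha_center E" if e: "e \<in> carrier E" for e
    proof -
      obtain x m where xm: "e = (x, m)" "x \<in> k1" "\<And>\<phi>. m \<phi> \<in> carrier K"
        using e by (auto simp: E_carrier)
      then show ?thesis using center[of x m] k1c[of x] by (auto simp: Z_iff k2_def)
    qed
  qed
qed

theorem theorem5p10:
  fixes K :: "('k, 'm) ring_scheme"
    and g :: "('k, 'a \<times> 'b) hom_algebra"
    and g1 :: "('k, 'a) hom_algebra"
    and g2 :: "('k, 'b) hom_algebra"
  assumes "field K"
    and "hom_leibniz_algebra K g"
    and "finite_dimensional K g"
    and "regular g"
    and "capable K g"
    and "hom_leibniz_algebra K g1"
    and "hom_leibniz_algebra K g2"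
    and "g = direct_sum g1 g2"
  shows "capable K g1 \<and> capable K g2"
proof -
  interpret g1: hom_leibniz_algebra K g1 by fact
  interpret g2: hom_leibniz_algebra K g2 by fact
  have g_simps: "carrier g = carrier g1 \<times> carrier g2" "\<zero>\<^bsub>g\<^esub> = (\<zero>\<^bsub>g1\<^esub>, \<zero>\<^bsub>g2\<^esub>)"
    "x \<oplus>\<^bsub>g\<^esub> y = (fst x \<oplus>\<^bsub>g1\<^esub> fst y, snd x \<oplus>\<^bsub>g2\<^esub> snd y)"
    "x \<otimes>\<^bsub>g\<^esub> y = (fst x \<otimes>\<^bsub>g1\<^esub> fst y, snd x \<otimes>\<^bsub>g2\<^esub> snd y)"
    "c \<odot>\<^bsub>g\<^esub> x = (c \<odot>\<^bsub>g1\<^esub> fst x, c \<odot>\<^bsub>g2\<^esub> snd x)"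
    "twist g x = (twist g1 (fst x), twist g2 (snd x))" for x y c
    by (simp_all add: assms(8) direct_sum_def case_prod_beta)
  obtain k :: "('k, ('k, 'a \<times> 'b) expression) hom_algebra" where k: "hom_leibniz_algebra K k"
    and iso: "hom_algebra_isomorphic K g (quotient_algebra k (alpha_center k))"
    using \<open>capable K g\<close> unfolding capable_def by blast
  interpret k: hom_leibniz_algebra K k by (fact k)
  obtain f where f: "f \<in> hom_algebra_hom K k g" "f ` carrier k = carrier g"
    and eq: "\<And>x y. x \<in> carrier k \<Longrightarrow> y \<in> carrier k \<Longrightarrow>
      f x = f y \<longleftrightarrow> x \<ominus>\<^bsub>k\<^esub> y \<in> alpha_center k"
    using iso unfolding isomorphic_quotient_iff[OF assms(2) k] by blast
  have ker: "f x = \<zero>\<^bsub>g\<^esub> \<longleftrightarrow> x \<in> alpha_center k" if "x \<in> carrier k" for x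
    using eq[OF that k.zero_closed] hom_algebra_hom_zero[OF k assms(2) f(1)] that
    by (simp add: a_minus_def k.minus_zero_eq)
  have p: "fst \<circ> f \<in> hom_algebra_hom K k g1" and q: "snd \<circ> f \<in> hom_algebra_hom K k g2"
    using f(1) unfolding hom_algebra_hom_def by (auto simp: g_simps mem_Times_iff Pi_iff)
  have onto: "\<exists>x\<in>carrier k. (fst \<circ> f) x = a \<and> (snd \<circ> f) x = b"
    if "a \<in> carrier g1" "b \<in> carrier g2" for a b
  proof -
    have "(a, b) \<in> f ` carrier k" using that f(2) by (simp add: g_simps)
    then show ?thesis by (metis comp_apply fst_conv imageE snd_conv)
  qed
  have surj: "twist g ` carrier g = carrier g"
    using \<open>regular g\<close> by (simp add: regular_def bij_betw_def)
  have surj1: "twist g1 ` carrier g1 = carrier g1"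
  proof
    show "carrier g1 \<subseteq> twist g1 ` carrier g1"
    proof
      fix a assume "a \<in> carrier g1"
      then have "(a, \<zero>\<^bsub>g2\<^esub>) \<in> twist g ` carrier g" unfolding surj by (simp add: g_simps)
      then show "a \<in> twist g1 ` carrier g1" by (auto simp: g_simps)
    qed
  qed (auto simp: g1.twist_closed)
  have surj2: "twist g2 ` carrier g2 = carrier g2"
  proof
    show "carrier g2 \<subseteq> twist g2 ` carrier g2"
    proof
      fix b assume "b \<in> carrier g2"
      then have "(\<zero>\<^bsub>g1\<^esub>, b) \<in> twist g ` carrier g" unfolding surj by (simp add: g_simps)
      then show "b \<in> twist g2 ` carrier g2" by (auto simp: g_simps)
    qed
  qed (auto simp: g2.twist_closed)
  have ker12: "(fst \<circ> f) x = \<zero>\<^bsub>g1\<^esub> \<and> (snd \<circ> f) x = \<zero>\<^bsub>g2\<^esub> \<longleftrightarrow> x \<in> alpha_center k"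
    if "x \<in> carrier k" for x
    using ker[OF that] by (simp add: g_simps prod_eq_iff)
  show ?thesis
  proof
    show "capable K g1"
      by (rule capable_first_factor[OF k assms(6,7) p q onto ker12 surj2])
    show "capable K g2"
    proof (rule capable_first_factor[OF k assms(7,6) q p _ _ surj1])
      show "\<exists>x\<in>carrier k. (snd \<circ> f) x = b \<and> (fst \<circ> f) x = a"
        if "b \<in> carrier g2" "a \<in> carrier g1" for a b
        using onto[OF that(2,1)] by blast
      show "(snd \<circ> f) x = \<zero>\<^bsub>g2\<^esub> \<and> (fst \<circ> f) x = \<zero>\<^bsub>g1\<^esub> \<longleftrightarrow> x \<in> alpha_center k"
        if "x \<in> carrier k" for x
        using ker12[OF that] by blast
    qed
  qed
qed

end
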